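(* For all $A,B\in\mathfrak{J}_n$ and $s,t\in\mathbb{R}$ the measure average satisfies: (1) (closure) $tA\oplus(1-t)B\in\mathfrak{J}_n$; (2) (interpolation) $0A\oplus1B=B$ and $1A\oplus0B=A$; (3) (submetric) $d_\mu\big(sA\oplus(1-s)B,\ tA\oplus(1-t)B\big)\le|t-s|\,d_\mu(A,B)$; and moreover for $s,t\in[0,1]$: (4) (measure) $\mu\big(tA\oplus(1-t)B\big)=t\mu(A)+(1-t)\mu(B)$; (5) (metric) $d_\mu\big(sA\oplus(1-s)B,\ tA\oplus(1-t)B\big)=|t-s|\,d_\mu(A,B)$; (6) (inclusion) $\operatorname{ci}(A\cap B)\subseteq tA\oplus(1-t)B\subseteq A\cup B$.
   Context: Notation: $\mu$ is $n$-dimensional Lebesgue measure; $\operatorname{ci}(E)$ is the closure of the interior of $E$; $\mathfrak{J}_n$ is the family of bounded sets $A\subset\mathbb{R}^n$ with $A=\operatorname{ci}(A)$ and $\mu(\partial A)=0$ (the empty set included); $d_\mu(A,B)=\mu(A\triangle B)$ (a metric on $\mathfrak{J}_n$). For nonempty bounded $A$: $d_S(p,A)=d(p,\partial A)$ if $p\in A$, $-d(p,\partial A)$ if $p\notin A$, where $d(q,E)=\min_{e\in E}\|q-e\|$. $O(B,r)=\{p:d(p,B)\le r\}$ for $r\ge0$. Distance average: for nonempty $A,B\in\mathfrak{J}_n$, $x\in\mathbb{R}$, $xA\,\widetilde\oplus\,(1-x)B=\{p: x d_S(p,A)+(1-x)d_S(p,B)\ge0\}$; if $A\ne\emptyset=B$,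 fix $q\in A$ maximizing $d_S(\cdot,A)$ over $A$ and set $xA\,\widetilde\oplus\,(1-x)B=\{p: x d_S(p,A)+(x-1)\|p-q\|\ge0\}$; the distance average of two empty sets is $\emptyset$. Let $h_{A,B}(x)=\mu(xA\,\widetilde\oplus\,(1-x)B)$. $A,B$ satisfy the zero-measure condition if $\mu(\{p: \tfrac12 d_S(p,A)+\tfrac12 d_S(p,B)=0\})=0$. Measure average $tA\oplus(1-t)B$ ($t\in\mathbb{R}$), defined in three steps (a fixed large number $N>0$ and, where needed, a fixed $\varepsilon>0$ are chosen once). Always $tA\oplus(1-t)A=A$. Step 1 (simply different: $B\subsetneq A$, $A\setminus B$ connected). If $A,B$ satisfy the zero-measure condition, or if $t\notin[0,1]$: $tA\oplus(1-t)B=\operatorname{ci}\big(gA\,\widetilde\oplus\,(1-g)B\big)$ where $g\in[-N,N]$ is any point attaining $\inf_{\xi\in[-N,N]}|h_{A,B}(\xi)-(t\mu(A)+(1-t)\mu(B))|$ (the set obtained does not depend on this choice). If the zero-measure condition fails and $t\in[0,1]$: $tA\oplus(1-t)B=\operatorname{ci}(O(B,r)\cap A)$ for any $r\ge0$ with $\mu(O(B,r)\cap A)=t\mu(A)+(1-t)\mu(B)$. Step 2 (nested: $B\subsetneq A$). If $A\setminus B$ has finitely many connected components, for each component $C$ let $R_{C,t}=t(B\cup C)\oplus(1-t)B$ (Step 1), and set $tA\oplus(1-t)B=\bigcup_C R_{C,t}$ for $t\ge0$ and $\operatorname{ci}\big(\bigcap_C R_{C,t}\big)$ for $t<0$. If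 there are infinitely many components, all components of measure $<\varepsilon$ are merged into one set $U$, which is treated as a single component in these formulas. Step 3 (general $A,B$). Let $I=\operatorname{ci}(A\cap B)$, $R_{1,t}=tA\oplus(1-t)I$ and $R_{2,t}=(1-t)B\oplus tI$ (Step 2 averages of nested pairs, weight first on the larger set). Then $tA\oplus(1-t)B=R_{1,t}\cup R_{2,t}$ for $t\in[0,1]$; $=\operatorname{ci}(R_{1,t}\setminus(A\cap B))\cup R_{2,t}$ for $t>1$; and for $t<0$ it is defined as $(1-t)B\oplus tA$, computed by the $t>1$ rule with the roles of $A$ and $B$ exchanged (parameter $1-t>1$). *)

theory Defs
  imports "HOL-Analysis.Analysis"
begin

definition ci :: "'a::topological_space set \<Rightarrow> 'a set" where
  "ci E = closure (interior E)"

definition Jn :: "'a::euclidean_space set set" where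
  "Jn = {A. bounded A \<and> A = ci A \<and> measure lebesgue (frontier A) = 0}"

definition dmu :: "'a::euclidean_space set \<Rightarrow> 'a set \<Rightarrow> real" where
  "dmu A B = measure lebesgue ((A - B) \<union> (B - A))"

definition sdist :: "'a::euclidean_space set \<Rightarrow> 'a \<Rightarrow> real" where
  "sdist A p = (if p \<in> A then infdist p (frontier A) else - infdist p (frontier A))"

definition center :: "'a::euclidean_space set \<Rightarrow> 'a" where
  "center A = (SOME q. q \<in> A \<and> (\<forall>p\<in>A. sdist A p \<le> sdist A q))"

definition sdist2 :: "'a::euclidean_space set \<Rightarrow> 'a set \<Rightarrow> 'a \<Rightarrow> real" where
  "sdist2 A B p = (if B = {} then - norm (p - center A) else sdist B p)"

text \<open>Distance average x A ~+ (1-x) B (only ever used with B a subset of A).\<close>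
definition davg :: "real \<Rightarrow> 'a::euclidean_space set \<Rightarrow> 'a set \<Rightarrow> 'a set" where
  "davg x A B = (if A = {} \<and> B = {} then {}
     else {p. x * sdist A p + (1 - x) * sdist2 A B p \<ge> 0})"

definition hfun :: "'a::euclidean_space set \<Rightarrow> 'a set \<Rightarrow> real \<Rightarrow> real" where
  "hfun A B x = measure lebesgue (davg x A B)"

definition zero_measure_cond :: "'a::euclidean_space set \<Rightarrow> 'a set \<Rightarrow> bool" where
  "zero_measure_cond A B \<longleftrightarrow>
     measure lebesgue {p. sdist A p / 2 + sdist2 A B p / 2 = 0} = 0"

definition Onbhd :: "'a::euclidean_space set \<Rightarrow> real \<Rightarrow> 'a set" where
  "Onbhd B r = {p. infdist p B \<le> r}"

definition step1 :: "real \<Rightarrow> real \<Rightarrow> 'a::euclidean_space set \<Rightarrow> 'a set \<Rightarrow> 'a set" where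
  "step1 N t A B =
    (let target = t * measure lebesgue A + (1 - t) * measure lebesgue B in
     if A = B then A
     else if zero_measure_cond A B \<or> t \<notin> {0..1} then
       ci (davg (SOME g. g \<in> {-N..N} \<and>
                 \<bar>hfun A B g - target\<bar> = (INF \<xi>\<in>{-N..N}. \<bar>hfun A B \<xi> - target\<bar>)) A B)
     else
       ci (Onbhd B (SOME r. r \<ge> 0 \<and> measure lebesgue (Onbhd B r \<inter> A) = target) \<inter> A))"

definition comp_family :: "real \<Rightarrow> 'a::euclidean_space set \<Rightarrow> 'a set \<Rightarrow> 'a set set" where
  "comp_family \<epsilon> A B =
    (let cs = components (A - B);
         small = {C\<in>cs. measure lebesgue C < \<epsilon>} in
     if finite cs then cs
     else {C\<in>cs. measure lebesgue C \<ge> \<epsilon>} \<union> (if small = {} then {} else {\<Union>small}))"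

definition step2 :: "real \<Rightarrow> real \<Rightarrow> real \<Rightarrow> 'a::euclidean_space set \<Rightarrow> 'a set \<Rightarrow> 'a set" where
  "step2 N \<epsilon> t A B =
    (if A = B then A
     else (let R = (\<lambda>C. step1 N t (B \<union> C) B) in
       if t \<ge> 0 then \<Union>(R ` comp_family \<epsilon> A B)
       else ci (\<Inter>(R ` comp_family \<epsilon> A B))))"

definition step3 :: "real \<Rightarrow> real \<Rightarrow> real \<Rightarrow> 'a::euclidean_space set \<Rightarrow> 'a set \<Rightarrow> 'a set" where
  "step3 N \<epsilon> t A B =
    (let I = ci (A \<inter> B);
         R1 = step2 N \<epsilon> t A I;
         R2 = step2 N \<epsilon> (1 - t) B I in
     if t \<in> {0..1} then R1 \<union> R2
     else if t > 1 then ci (R1 - (A \<inter> B)) \<union> R2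
     else ci (R2 - (B \<inter> A)) \<union> R1)"

definition mavg :: "real \<Rightarrow> real \<Rightarrow> real \<Rightarrow> 'a::euclidean_space set \<Rightarrow> 'a set \<Rightarrow> 'a set" where
  "mavg N \<epsilon> t A B =
    (if A = B then A
     else if B \<subset> A then step2 N \<epsilon> t A B
     else if A \<subset> B then step2 N \<epsilon> (1 - t) B A
     else step3 N \<epsilon> t A B)"

end

theory Submission
  imports Defs
begin

text \<open>For a nested pair \<open>B \<subseteq> A\<close> the distance averages \<open>E x\<close> increase with \<open>x\<close>, because signed
  distance is monotone in the set. A signed distance function changes at unit speed towards a nearest
  boundary point, while every other one is 1-Lipschitz, so the level set
  \<open>{p. x * sdist A p + (1 - x) * sdist B p = 0}\<close> is porous, hence null, unless \<open>x = 1/2\<close>. Consequently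
  all Step 1 averages come from one chain of Jordan measurable sets, and their measure is the
  affine target value clamped to the range of \<open>h\<close> on \<open>{-N..N}\<close>; along a chain \<open>dmu\<close> is the difference of
  the measures, which gives the submetric inequality. It passes to finite unions and
  intersections (Step 2) and to Step 3 by subadditivity of \<open>dmu\<close>. On \<open>{0..1}\<close>, equality follows from
  the triangle inequality and the values at 0 and 1. The bound \<open>N \<ge> 1\<close> only serves
  to have 0 and 1 in \<open>{-N..N}\<close>.\<close>

section \<open>Regular closed sets and Jordan measurable sets\<close>

text \<open>The obstacle is the parameter 1/2: there the two signed distances carry equal weights,
  their changes may cancel, and \<open>h\<close> can jump, so a target inside the jump is missed by
  every distance average. Step 1 then uses the sets \<open>Onbhd B r \<inter> A\<close> on [0,1],
  which fit into the chain because they lie between \<open>E 0\<close> and \<open>E 1\<close>. A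
  second difficulty is that the sets on the way are often not regular closed; the union of
  \<open>B\<close> with the merged small components, for instance, need not even be closed. Most of
  the work is therefore done with bounded sets whose frontier is null, where \<open>ci\<close>
  changes a set only by a null set. Finally, \<open>SOME\<close> gives no control over the parameter
  or radius chosen. Within a chain the measure determines \<open>ci\<close> of the set, for Jordan
  sets and also for closed ones, so only the measure of the chosen set matters.\<close>

lemma ci_mono: "A \<subseteq> B \<Longrightarrow> ci A \<subseteq> ci B"
  unfolding ci_def by (intro closure_mono interior_mono)

lemma ci_empty [simp]: "ci {} = {}"
  by (simp add: ci_def)

lemma interior_subset_ci: "interior A \<subseteq> ci A"
  unfolding ci_def by (rule closure_subset)

lemma ci_subset_closure: "ci A \<subseteq> closure A"
  unfolding ci_def by (intro closure_mono interior_subset)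

lemma closed_ci: "closed (ci A)"
  by (simp add: ci_def)

lemma ci_ci [simp]: "ci (ci A) = ci A"
proof
  show "ci (ci A) \<subseteq> ci A"
    using ci_subset_closure[of "ci A"] closed_ci[of A] by simp
  show "ci A \<subseteq> ci (ci A)"
    unfolding ci_def
    by (intro closure_mono) (simp add: closure_subset interior_maximal)
qed

lemma ci_Un_eq:
  assumes "A = ci A" "B = ci B"
  shows "A \<union> B = ci (A \<union> B)"
proof
  show "A \<union> B \<subseteq> ci (A \<union> B)"
    using assms ci_mono[of A "A \<union> B"] ci_mono[of B "A \<union> B"] by blast
  have "closed (A \<union> B)"
    using assms closed_ci by (metis closed_Un)
  then show "ci (A \<union> B) \<subseteq> A \<union> B"
    using ci_subset_closure[of "A \<union> B"] closure_closed by metis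
qed

text \<open>Jordan measurability without regularity: unlike membership in \<open>Jn\<close> it
  survives intersections and differences, so it serves for sets to which \<open>ci\<close> has yet
  to be applied.\<close>

definition jordan :: "'a::euclidean_space set \<Rightarrow> bool" where
  "jordan A \<longleftrightarrow> bounded A \<and> negligible (frontier A)"

lemma jordan_empty [simp]: "jordan {}"
  by (simp add: jordan_def)

lemma jordan_Un: "jordan A \<Longrightarrow> jordan B \<Longrightarrow> jordan (A \<union> B)"
  unfolding jordan_def using frontier_Un_subset[of A B]
  by (meson bounded_Un negligible_Un negligible_subset)

lemma jordan_Int: "jordan A \<Longrightarrow> jordan B \<Longrightarrow> jordan (A \<inter> B)"
  unfolding jordan_def using frontier_Int_subset[of A B]
  by (meson bounded_Int negligible_Un negligible_subset)

lemma jordan_Diff: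
  assumes "jordan A" "jordan B"
  shows "jordan (A - B)"
proof -
  have "frontier (A - B) \<subseteq> frontier A \<union> frontier B"
    using frontier_Int_subset[of A "- B"] by (simp add: Diff_eq)
  then show ?thesis
    using assms unfolding jordan_def
    by (meson bounded_diff negligible_Un negligible_subset)
qed

lemma jordan_INT:
  assumes "finite F" "F \<noteq> {}" "\<And>C. C \<in> F \<Longrightarrow> jordan (R C)"
  shows "jordan (\<Inter>C\<in>F. R C)"
  using assms by (induction F rule: finite_ne_induct) (auto intro: jordan_Int)

lemma frontier_ci_subset: "frontier (ci A) \<subseteq> frontier A"
  unfolding frontier_def ci_def
  by (metis Diff_mono closure_closure closure_mono closure_subset interior_maximal
      interior_subset open_interior)

lemma symdiff_ci_subset_frontier: "(A - ci A) \<union> (ci A - A) \<subseteq> frontier A"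
  using interior_subset_ci[of A] ci_subset_closure[of A] closure_subset[of A] interior_subset[of A]
  unfolding frontier_def by blast

lemma jordan_ci: "jordan A \<Longrightarrow> jordan (ci A)"
  unfolding jordan_def
  by (meson bounded_closure bounded_subset ci_subset_closure frontier_ci_subset negligible_subset)

lemma jordan_closure: "jordan A \<Longrightarrow> jordan (closure A)"
  unfolding jordan_def frontier_def
  using interior_mono[OF closure_subset[of A]] by (auto elim!: negligible_subset)

lemma jordan_lmeasurable:
  assumes "jordan A"
  shows "A \<in> lmeasurable"
proof -
  have "(interior A - A) \<union> (A - interior A) \<subseteq> frontier A"
    using closure_subset interior_subset unfolding frontier_def by blast
  then show ?thesis
    using assms lmeasurable_interior unfolding jordan_def
    by (meson lmeasurable_negligible_symdiff negligible_subset)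
qed

text \<open>\<open>measure\<close> also returns 0 on sets of infinite measure. Boundedness rules
  this out, so the condition in \<open>Jn\<close> really says that the frontier is null.\<close>

lemma Jn_iff_jordan: "A \<in> Jn \<longleftrightarrow> jordan A \<and> ci A = A"
proof -
  have "measure lebesgue (frontier A) = 0 \<longleftrightarrow> negligible (frontier A)" if "bounded A"
    using that by (simp add: negligible_iff_measure lmeasurable_frontier)
  then show ?thesis
    unfolding Jn_def jordan_def by auto
qed

lemma ci_in_Jn: "jordan A \<Longrightarrow> ci A \<in> Jn"
  by (simp add: Jn_iff_jordan jordan_ci)

lemma Un_in_Jn: "A \<in> Jn \<Longrightarrow> B \<in> Jn \<Longrightarrow> A \<union> B \<in> Jn"
  by (metis Jn_iff_jordan ci_Un_eq jordan_Un)

lemma empty_in_Jn: "{} \<in> Jn"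
  by (simp add: Jn_iff_jordan)

lemma UN_in_Jn:
  assumes "finite F" "\<And>C. C \<in> F \<Longrightarrow> R C \<in> Jn"
  shows "(\<Union>C\<in>F. R C) \<in> Jn"
  using assms by (induction F rule: finite_induct) (auto intro: Un_in_Jn empty_in_Jn)

lemma Jn_closed: "A \<in> Jn \<Longrightarrow> closed A"
  by (metis Jn_iff_jordan closed_ci)

lemma open_negligible_empty: "open S \<Longrightarrow> negligible S \<Longrightarrow> S = {}"
  using open_not_negligible by blast

lemma negligible_diff_of_measure_eq:
  assumes "F \<subseteq> F'" "F \<in> lmeasurable" "F' \<in> lmeasurable" "measure lebesgue F' \<le> measure lebesgue F"
  shows "negligible (F' - F)"
  using assms measure_mono_fmeasurable[of F F' lebesgue]
  by (simp add: negligible_iff_measure fmeasurable.Diff measurable_measure_Diff fmeasurableD)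

text \<open>A null open set is empty. The part of \<open>interior F'\<close> outside
  \<open>closure (interior F)\<close> is open and is contained in \<open>F' - F\<close> together
  with \<open>frontier F\<close>, both of which are null.\<close>

lemma ci_eq_of_measure_le_jordan:
  assumes "F \<subseteq> F'" "jordan F" "jordan F'" "measure lebesgue F' \<le> measure lebesgue F"
  shows "ci F = ci F'"
proof
  show "ci F \<subseteq> ci F'"
    by (rule ci_mono) fact
  let ?W = "interior F' - closure (interior F)"
  have "?W \<subseteq> (F' - F) \<union> frontier F"
    using interior_subset closure_subset unfolding frontier_def by blast
  moreover have "negligible ((F' - F) \<union> frontier F)"
    using negligible_diff_of_measure_eq[of F F'] assms jordan_lmeasurable
    by (auto simp: jordan_def)
  ultimately have "?W = {}"
    by (metis closed_closure negligible_subset open_Diff open_interior open_negligible_empty)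
  then show "ci F' \<subseteq> ci F"
    unfolding ci_def by (metis Diff_eq_empty_iff closure_minimal closed_closure)
qed

text \<open>Closedness replaces the null frontier: already \<open>interior F' - F\<close> is open
  and null. This is meant for sets \<open>E x\<close> at an arbitrary optimal parameter, whose
  frontier is not known to be null.\<close>

lemma ci_eq_of_measure_le_closed:
  assumes "F \<subseteq> F'" "closed F" "F \<in> lmeasurable" "F' \<in> lmeasurable"
    "measure lebesgue F' \<le> measure lebesgue F"
  shows "ci F = ci F'"
proof -
  have "interior F' - F \<subseteq> F' - F"
    using interior_subset by blast
  then have "interior F' - F = {}"
    using negligible_diff_of_measure_eq[of F F'] assms
    by (intro open_negligible_empty) (auto intro: negligible_subset)
  then have "interior F' = interior F"
    by (metis Diff_eq_empty_iff assms(1) interior_maximal interior_mono open_interior subset_antisym)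
  then show ?thesis
    by (simp add: ci_def)
qed

lemma Jn_eq_of_measure_le:
  assumes "F \<subseteq> F'" "F \<in> Jn" "F' \<in> Jn" "measure lebesgue F' \<le> measure lebesgue F"
  shows "F = F'"
  using ci_eq_of_measure_le_jordan[OF assms(1)] assms by (simp add: Jn_iff_jordan)

section \<open>The symmetric difference pseudometric\<close>

lemma dmu_refl [simp]: "dmu A A = 0"
  by (simp add: dmu_def)

lemma dmu_commute: "dmu A B = dmu B A"
  by (simp add: dmu_def Un_commute)

lemma dmu_nonneg [simp]: "0 \<le> dmu A B"
  by (simp add: dmu_def)

lemma symdiff_lmeasurable [intro, simp]:
  "A \<in> lmeasurable \<Longrightarrow> B \<in> lmeasurable \<Longrightarrow> (A - B) \<union> (B - A) \<in> lmeasurable"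
  by (intro fmeasurable.Un fmeasurable.Diff) auto

text \<open>Common source of the triangle inequality and of the stability of \<open>dmu\<close>
  under union, intersection and difference: each of these is an inclusion between symmetric
  differences.\<close>

lemma dmu_le_add:
  assumes "(A - B) \<union> (B - A) \<subseteq> ((C - D) \<union> (D - C)) \<union> ((E - F) \<union> (F - E))"
    "A \<in> lmeasurable" "B \<in> lmeasurable" "C \<in> lmeasurable" "D \<in> lmeasurable"
    "E \<in> lmeasurable" "F \<in> lmeasurable"
  shows "dmu A B \<le> dmu C D + dmu E F"
proof -
  have "dmu A B \<le> measure lebesgue (((C - D) \<union> (D - C)) \<union> ((E - F) \<union> (F - E)))"
    unfolding dmu_def using assms
    by (intro measure_mono_fmeasurable) (auto intro!: fmeasurable.Un fmeasurable.Diff)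
  also have "\<dots> \<le> dmu C D + dmu E F"
    unfolding dmu_def using assms by (intro measure_Un_le) (auto intro: fmeasurableD)
  finally show ?thesis .
qed

lemma dmu_triangle:
  "A \<in> lmeasurable \<Longrightarrow> B \<in> lmeasurable \<Longrightarrow> C \<in> lmeasurable \<Longrightarrow> dmu A C \<le> dmu A B + dmu B C"
  by (rule dmu_le_add) auto

lemma dmu_Un_le:
  "A \<in> lmeasurable \<Longrightarrow> B \<in> lmeasurable \<Longrightarrow> C \<in> lmeasurable \<Longrightarrow> D \<in> lmeasurable \<Longrightarrow>
    dmu (A \<union> B) (C \<union> D) \<le> dmu A C + dmu B D"
  by (rule dmu_le_add) (auto intro!: fmeasurable.Un)

lemma dmu_Int_le:
  "A \<in> lmeasurable \<Longrightarrow> B \<in> lmeasurable \<Longrightarrow> C \<in> lmeasurable \<Longrightarrow> D \<in> lmeasurable \<Longrightarrow>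
    dmu (A \<inter> B) (C \<inter> D) \<le> dmu A C + dmu B D"
  by (rule dmu_le_add) (auto intro!: fmeasurable_Int_fmeasurable fmeasurableD)

lemma dmu_Diff_le:
  assumes "A \<in> lmeasurable" "B \<in> lmeasurable" "C \<in> lmeasurable"
  shows "dmu (A - C) (B - C) \<le> dmu A B"
  using dmu_le_add[of "A - C" "B - C" A B A A] assms
  by (force intro: fmeasurable.Diff)

lemma dmu_UN_le:
  assumes "finite F" "\<And>C. C \<in> F \<Longrightarrow> R C \<in> lmeasurable" "\<And>C. C \<in> F \<Longrightarrow> R' C \<in> lmeasurable"
  shows "dmu (\<Union>C\<in>F. R C) (\<Union>C\<in>F. R' C) \<le> (\<Sum>C\<in>F. dmu (R C) (R' C))"
  using assms
proof (induction F rule: finite_induct)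
  case (insert C F)
  have "dmu (R C \<union> (\<Union>C\<in>F. R C)) (R' C \<union> (\<Union>C\<in>F. R' C))
      \<le> dmu (R C) (R' C) + dmu (\<Union>C\<in>F. R C) (\<Union>C\<in>F. R' C)"
    using insert by (intro dmu_Un_le) (auto intro!: fmeasurable.finite_UN)
  then show ?case
    using insert by fastforce
qed simp

lemma dmu_INT_le:
  assumes "finite F" "F \<noteq> {}" "\<And>C. C \<in> F \<Longrightarrow> R C \<in> lmeasurable" "\<And>C. C \<in> F \<Longrightarrow> R' C \<in> lmeasurable"
  shows "dmu (\<Inter>C\<in>F. R C) (\<Inter>C\<in>F. R' C) \<le> (\<Sum>C\<in>F. dmu (R C) (R' C))"
  using assms
proof (induction F rule: finite_ne_induct)
  case (insert C F)
  have INT: "(\<Inter>C\<in>F. Q C) \<in> lmeasurable" if "\<And>C. C \<in> F \<Longrightarrow> Q C \<in> lmeasurable" for Q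
    using insert.hyps(1,2) that
    by (induction F rule: finite_ne_induct) (auto intro!: fmeasurable_Int_fmeasurable fmeasurableD)
  have "dmu (R C \<inter> (\<Inter>C\<in>F. R C)) (R' C \<inter> (\<Inter>C\<in>F. R' C))
      \<le> dmu (R C) (R' C) + dmu (\<Inter>C\<in>F. R C) (\<Inter>C\<in>F. R' C)"
    using insert by (intro dmu_Int_le INT) auto
  then show ?case
    using insert by fastforce
qed simp

lemma dmu_eq_0:
  "negligible ((A - B) \<union> (B - A)) \<Longrightarrow> dmu A B = 0"
  unfolding dmu_def by (rule negligible_imp_measure0)

lemma dmu_ci: "jordan A \<Longrightarrow> dmu (ci A) A = 0"
  using symdiff_ci_subset_frontier[of A] unfolding jordan_def
  by (intro dmu_eq_0) (auto intro: negligible_subset)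

lemma dmu_ci_left:
  assumes "jordan A" "B \<in> lmeasurable"
  shows "dmu (ci A) B = dmu A B"
proof -
  have "A \<in> lmeasurable" "ci A \<in> lmeasurable"
    using assms jordan_lmeasurable jordan_ci by auto
  then show ?thesis
    using dmu_triangle[of A "ci A" B] dmu_triangle[of "ci A" A B] assms dmu_ci[of A]
    by (simp add: dmu_commute)
qed

lemma measure_ci: "jordan A \<Longrightarrow> measure lebesgue (ci A) = measure lebesgue A"
proof (rule measure_negligible_symdiff)
  assume "jordan A"
  then show "A \<in> lmeasurable" by (rule jordan_lmeasurable)
  show "negligible ((A - ci A) \<union> (ci A - A))"
    using symdiff_ci_subset_frontier[of A] \<open>jordan A\<close> unfolding jordan_def
    by (auto intro: negligible_subset)
qed

lemma dmu_mono_eq: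
  assumes "A \<subseteq> B" "A \<in> lmeasurable" "B \<in> lmeasurable"
  shows "dmu A B = measure lebesgue B - measure lebesgue A"
proof -
  have "(A - B) \<union> (B - A) = B - A"
    using assms(1) by blast
  then show ?thesis
    unfolding dmu_def using assms measurable_measure_Diff[of B lebesgue A]
    by (simp add: fmeasurableD)
qed

text \<open>The averages follow different rules on the two sides of 0 and of 1. Parameters on
  opposite sides of \<open>a\<close> are joined through \<open>f a\<close>, without loss because the
  two parameter lengths add up.\<close>

lemma submetric_glue:
  fixes f :: "real \<Rightarrow> 'a::euclidean_space set"
  assumes meas: "\<And>t. f t \<in> lmeasurable"
    and le: "\<And>s t. s \<le> a \<Longrightarrow> t \<le> a \<Longrightarrow> dmu (f s) (f t) \<le> \<bar>t - s\<bar> * L"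
    and ge: "\<And>s t. s \<ge> a \<Longrightarrow> t \<ge> a \<Longrightarrow> dmu (f s) (f t) \<le> \<bar>t - s\<bar> * L"
  shows "dmu (f s) (f t) \<le> \<bar>t - s\<bar> * L"
proof -
  have across: "dmu (f x) (f y) \<le> \<bar>y - x\<bar> * L" if "x \<le> a" "a \<le> y" for x y
  proof -
    have "dmu (f x) (f y) \<le> dmu (f x) (f a) + dmu (f a) (f y)"
      by (rule dmu_triangle) (rule meas)+
    also have "\<dots> \<le> \<bar>a - x\<bar> * L + \<bar>y - a\<bar> * L"
      using le[of x a] ge[of a y] that by auto
    also have "\<dots> = \<bar>y - x\<bar> * L"
      using that by (simp add: algebra_simps)
    finally show ?thesis .
  qed
  show ?thesis
    using le[of s t] ge[of s t] across[of s t] across[of t s]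
    by (cases "s \<le> a"; cases "t \<le> a") (auto simp: dmu_commute abs_minus_commute)
qed

section \<open>Null level sets\<close>

lemma emeasure_ball_scale:
  fixes x y :: "'a::euclidean_space"
  assumes "c \<ge> 0" "r \<ge> 0"
  shows "emeasure lebesgue (ball y (c * r)) = ennreal (c ^ DIM('a)) * emeasure lebesgue (ball x r)"
proof -
  have "emeasure lebesgue (ball y (c * r)) = ennreal (c ^ DIM('a) * (unit_ball_vol (DIM('a)) * r ^ DIM('a)))"
    using assms by (simp add: emeasure_ball power_mult_distrib mult.left_commute)
  also have "\<dots> = ennreal (c ^ DIM('a)) * ennreal (unit_ball_vol (DIM('a)) * r ^ DIM('a))"
    using assms by (intro ennreal_mult) auto
  finally show ?thesis
    using assms by (simp add: emeasure_ball)
qed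

text \<open>A Vitali argument: disjoint balls centred in \<open>S\<close> cover almost all of
  \<open>S\<close> inside a tight open \<open>U\<close>. Each contains a hole of proportional
  measure, and together the holes would need more room than \<open>U - S\<close> offers.\<close>

lemma porous_lmeasurable_negligible:
  fixes S :: "'a::euclidean_space set"
  assumes "S \<in> lmeasurable" "c > 0"
    and porous: "\<And>x d. x \<in> S \<Longrightarrow> d > 0 \<Longrightarrow>
      \<exists>r y. 0 < r \<and> r < d \<and> ball y (c * r) \<subseteq> ball x r - S"
  shows "negligible S"
proof (rule ccontr)
  \<comment> \<open>A lower bound for the total measure of the holes; \<open>U\<close> is chosen so
    that \<open>U - S\<close> stays below it.\<close>
  let ?e = "c ^ DIM('a) * measure lebesgue S"
  assume "\<not> negligible S"
  then have "measure lebesgue S > 0"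
    using assms(1) by (simp add: negligible_iff_measure zero_less_measure_iff)
  then have e: "?e > 0"
    using \<open>c > 0\<close> by simp
  obtain U where U: "open U" "S \<subseteq> U" "U - S \<in> lmeasurable"
    "emeasure lebesgue (U - S) < ennreal ?e"
    using sets_lebesgue_outer_open[of S ?e] e assms(1) by (auto dest: fmeasurableD)
  define K where "K = {(x, r). x \<in> S \<and> 0 < r \<and> ball x r \<subseteq> U \<and>
    (\<exists>y. ball y (c * r) \<subseteq> ball x r - S)}"
  have cover: "\<exists>i. i \<in> K \<and> x \<in> ball (fst i) (snd i) \<and> snd i < d" if x: "x \<in> S" "0 < d" for x d
  proof -
    obtain k where k: "k > 0" "ball x k \<subseteq> U"
      using U(1,2) \<open>x \<in> S\<close> by (meson open_contains_ball subsetD)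
    obtain r y where "0 < r" "r < min d k" "ball y (c * r) \<subseteq> ball x r - S"
      using porous[of x "min d k"] x k by (metis min_less_iff_conj)
    moreover from this have "ball x r \<subseteq> U"
      using k by force
    ultimately show ?thesis
      using that unfolding K_def by (intro exI[of _ "(x, r)"]) auto
  qed
  obtain C where C: "countable C" "C \<subseteq> K"
    "pairwise (\<lambda>i j. disjnt (ball (fst i) (snd i)) (ball (fst j) (snd j))) C"
    "negligible (S - (\<Union>i\<in>C. ball (fst i) (snd i)))"
    using Vitali_covering_theorem_balls[of S K fst snd, OF cover] by blast
  have "\<forall>i\<in>C. \<exists>y. ball y (c * snd i) \<subseteq> ball (fst i) (snd i) - S"
    using C(2) unfolding K_def by auto
  then obtain y where y: "\<And>i. i \<in> C \<Longrightarrow> ball (y i) (c * snd i) \<subseteq> ball (fst i) (snd i) - S"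
    by metis
  let ?B = "\<lambda>i. ball (fst i) (snd i)" and ?H = "\<lambda>i. ball (y i) (c * snd i)"
  have disB: "disjoint_family_on ?B C"
    using C(3) unfolding disjoint_family_on_def pairwise_def disjnt_def by blast
  have disH: "disjoint_family_on ?H C"
    using disB y unfolding disjoint_family_on_def by blast
  have UB: "(\<Union>i\<in>C. ?B i) \<in> sets lebesgue"
    using C(1) by (intro sets.countable_UN') auto
  have "ennreal ?e = ennreal (c ^ DIM('a)) * emeasure lebesgue S"
    using assms by (simp add: emeasure_eq_measure2 ennreal_mult)
  also have "emeasure lebesgue S \<le> emeasure lebesgue ((\<Union>i\<in>C. ?B i) \<union> (S - (\<Union>i\<in>C. ?B i)))"
    by (intro emeasure_mono sets.Un UB negligible_imp_sets[OF C(4)]) auto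
  also have "\<dots> = emeasure lebesgue (\<Union>i\<in>C. ?B i)"
    using UB C(4) by (intro emeasure_Un_null_set) (simp_all add: negligible_iff_null_sets)
  also have "\<dots> = (\<integral>\<^sup>+i. emeasure lebesgue (?B i) \<partial>count_space C)"
    using C disB by (intro emeasure_UN_countable) auto
  also have "ennreal (c ^ DIM('a)) * \<dots> =
      (\<integral>\<^sup>+i. ennreal (c ^ DIM('a)) * emeasure lebesgue (?B i) \<partial>count_space C)"
    by (rule nn_integral_cmult[symmetric]) auto
  also have "\<dots> = (\<integral>\<^sup>+i. emeasure lebesgue (?H i) \<partial>count_space C)"
  proof (rule nn_integral_cong)
    fix i assume "i \<in> space (count_space C)"
    then have "snd i \<ge> 0"
      using C(2) unfolding K_def by auto
    then show "ennreal (c ^ DIM('a)) * emeasure lebesgue (?B i) = emeasure lebesgue (?H i)"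
      using emeasure_ball_scale[of c "snd i" "y i" "fst i"] \<open>c > 0\<close> by simp
  qed
  also have "\<dots> = emeasure lebesgue (\<Union>i\<in>C. ?H i)"
    using C disH by (intro emeasure_UN_countable[symmetric]) auto
  also have "\<dots> \<le> emeasure lebesgue (U - S)"
  proof (rule emeasure_mono)
    show "(\<Union>i\<in>C. ?H i) \<subseteq> U - S"
      using y C(2) unfolding K_def by fastforce
  qed (use U in \<open>auto dest: fmeasurableD\<close>)
  finally have "ennreal ?e \<le> emeasure lebesgue (U - S)"
    by (simp add: mult_left_mono)
  with U(4) show False
    by simp
qed

lemma porous_negligible:
  fixes S :: "'a::euclidean_space set"
  assumes "S \<in> sets lebesgue" "c > 0"
    and porous: "\<And>x d. x \<in> S \<Longrightarrow> d > 0 \<Longrightarrow>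
      \<exists>r y. 0 < r \<and> r < d \<and> ball y (c * r) \<subseteq> ball x r - S"
  shows "negligible S"
proof (subst negligible_on_intervals, intro allI)
  fix a b :: 'a
  show "negligible (S \<inter> cbox a b)"
  proof (rule porous_lmeasurable_negligible[OF _ \<open>c > 0\<close>])
    show "S \<inter> cbox a b \<in> lmeasurable"
      using fmeasurable_Int_fmeasurable[OF lmeasurable_cbox assms(1)] by (simp add: Int_commute)
  qed (use porous in blast)
qed

text \<open>A substitute for a gradient of length one that asks for no differentiability: at every
  small radius some point realizes the largest change a 1-Lipschitz function can have.\<close>

definition unit_slope_off :: "('a::euclidean_space \<Rightarrow> real) \<Rightarrow> 'a set \<Rightarrow> bool" where
  "unit_slope_off u Z \<longleftrightarrow> (\<forall>p. p \<notin> Z \<longrightarrow> (\<exists>\<rho>>0. \<forall>s. 0 < s \<and> s < \<rho> \<longrightarrow>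
      (\<exists>q. dist p q = s \<and> s \<le> \<bar>u q - u p\<bar>)))"

text \<open>From a zero \<open>p\<close> outside \<open>Z\<close>, the \<open>u\<close> term can be
  changed by at least \<open>\<bar>a\<bar> * s\<close> within distance \<open>s\<close>, while the
  \<open>v\<close> term cancels at most \<open>\<bar>b\<bar> * s\<close>. What remains keeps a ball
  of size proportional to \<open>s\<close> free of zeros, so the level set is porous off
  \<open>Z\<close>. The offset \<open>e\<close> admits nonzero levels.\<close>

lemma negligible_level_set:
  fixes u v :: "'a::euclidean_space \<Rightarrow> real"
  assumes lip: "\<And>p q. \<bar>u p - u q\<bar> \<le> dist p q" "\<And>p q. \<bar>v p - v q\<bar> \<le> dist p q"
    and slope: "unit_slope_off u Z" and Z: "closed Z" "negligible Z"
    and ab: "\<bar>b\<bar> < \<bar>a\<bar>"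
  shows "negligible {p. a * u p + b * v p + e = 0}"
proof -
  define f where "f p = a * u p + b * v p + e" for p
  define L \<kappa> where "L = \<bar>a\<bar> + \<bar>b\<bar>" and "\<kappa> = \<bar>a\<bar> - \<bar>b\<bar>"
  have pos: "L > 0" "\<kappa> > 0" "\<kappa> \<le> L"
    using ab by (auto simp: L_def \<kappa>_def)
  have flip: "\<bar>f p - f q\<bar> \<le> L * dist p q" for p q
  proof -
    have "f p - f q = a * (u p - u q) + b * (v p - v q)"
      by (simp add: f_def algebra_simps)
    also have "\<bar>\<dots>\<bar> \<le> \<bar>a\<bar> * \<bar>u p - u q\<bar> + \<bar>b\<bar> * \<bar>v p - v q\<bar>"
      by (metis abs_mult abs_triangle_ineq)
    also have "\<dots> \<le> \<bar>a\<bar> * dist p q + \<bar>b\<bar> * dist p q"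
      using lip by (intro add_mono mult_left_mono) auto
    finally show ?thesis
      by (simp add: L_def algebra_simps)
  qed
  have "continuous_on UNIV f"
    using flip pos by (intro lipschitz_on_continuous_on[of L] lipschitz_onI) (auto simp: dist_real_def)
  then have "closed {p. f p = 0}"
    using continuous_closed_preimage_constant[of UNIV f 0] by simp
  then have S: "{p. f p = 0} - Z \<in> sets lebesgue"
    using Z by (auto intro!: sets.Diff)
  have "negligible ({p. f p = 0} - Z)"
  proof (rule porous_negligible[OF S])
    show "\<kappa> / (2 * L) > 0"
      using pos by simp
    fix p and d :: real assume p: "p \<in> {p. f p = 0} - Z" and "d > 0"
    obtain \<rho> where \<rho>: "\<rho> > 0" "\<And>s. 0 < s \<Longrightarrow> s < \<rho> \<Longrightarrow> \<exists>q. dist p q = s \<and> s \<le> \<bar>u q - u p\<bar>"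
      using slope p unfolding unit_slope_off_def by blast
    define s where "s = min \<rho> d / 3"
    have s: "0 < s" "s < \<rho>" "2 * s < d"
      using \<rho>(1) \<open>d > 0\<close> by (auto simp: s_def)
    obtain q where q: "dist p q = s" "s \<le> \<bar>u q - u p\<bar>"
      using \<rho>(2)[of s] s by auto
    have "\<bar>a * (u q - u p)\<bar> \<ge> \<bar>a\<bar> * s" "\<bar>b * (v q - v p)\<bar> \<le> \<bar>b\<bar> * s"
      using q lip(2)[of q p] by (auto simp: abs_mult dist_commute intro!: mult_left_mono)
    moreover have "f q = a * (u q - u p) + b * (v q - v p)"
      using p by (simp add: f_def algebra_simps)
    ultimately have fq: "\<bar>f q\<bar> \<ge> \<kappa> * s"
      by (simp add: \<kappa>_def algebra_simps)
    \<comment> \<open>The hole has radius \<open>\<kappa> * s / L\<close>. This is at most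
      \<open>s\<close>, so the hole stays within \<open>2 * s\<close> of \<open>p\<close>, and it is
      too short for the \<open>L\<close>-Lipschitz \<open>f\<close> to come from size
      \<open>\<kappa> * s\<close> down to 0.\<close>
    have "ball q (\<kappa> / (2 * L) * (2 * s)) \<subseteq> ball p (2 * s) - ({p. f p = 0} - Z)"
    proof
      fix z assume "z \<in> ball q (\<kappa> / (2 * L) * (2 * s))"
      then have z: "dist q z < \<kappa> * s / L"
        by simp
      have "\<kappa> * s / L \<le> s"
        using pos s by (simp add: divide_simps mult.commute)
      then have "dist p z < 2 * s"
        using z q(1) dist_triangle[of p z q] by linarith
      moreover have "L * dist q z < \<kappa> * s"
        using z pos by (simp add: field_simps)
      then have "f z \<noteq> 0"
        using flip[of q z] fq by auto
      ultimately show "z \<in> ball p (2 * s) - ({p. f p = 0} - Z)"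
        by simp
    qed
    then show "\<exists>r y. 0 < r \<and> r < d \<and> ball y (\<kappa> / (2 * L) * r) \<subseteq> ball p r - ({p. f p = 0} - Z)"
      using s by (intro exI[of _ "2 * s"] exI[of _ q]) auto
  qed
  then have "negligible (({p. f p = 0} - Z) \<union> Z)"
    using Z(2) negligible_Un by blast
  then show ?thesis
    by (rule negligible_subset) (auto simp: f_def)
qed

text \<open>Walk straight towards a nearest point: the distance to that point drops by exactly
  \<open>s\<close>, and the triangle inequality excludes a larger drop of
  \<open>infdist\<close>.\<close>

lemma infdist_toward_nearest:
  fixes F :: "'a::euclidean_space set"
  assumes "closed F" "F \<noteq> {}" "p \<notin> F" "0 < s" "s < infdist p F"
  obtains q where "dist p q = s" "infdist q F = infdist p F - s"
proof -
  obtain a where a: "a \<in> F" "infdist p F = dist p a"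
    using infdist_attains_inf[OF assms(1,2)] by metis
  define q where "q = p + (s / dist p a) *\<^sub>R (a - p)"
  have d: "dist p a > 0"
    using assms a by auto
  have pq: "dist p q = s"
    using d assms by (simp add: q_def dist_norm norm_minus_commute)
  have "q - a = (1 - s / dist p a) *\<^sub>R (p - a)"
    by (simp add: q_def algebra_simps)
  then have "dist q a = \<bar>1 - s / dist p a\<bar> * dist p a"
    by (simp add: dist_norm)
  also have "\<dots> = dist p a - s"
    using d assms a by (simp add: abs_if field_simps)
  finally have "infdist q F \<le> infdist p F - s"
    using infdist_le[OF a(1), of q] a by simp
  moreover have "infdist p F \<le> infdist q F + s"
    using infdist_triangle[of p F q] pq by simp
  ultimately show ?thesis
    using that pq by force
qed

text \<open>Only the modulus of \<open>u\<close> is prescribed. Since it drops by \<open>s\<close>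
  on the way to a nearest point, \<open>u\<close> itself changes by at least \<open>s\<close>,
  whatever its signs.\<close>

lemma unit_slope_off_abs_infdist:
  fixes F :: "'a::euclidean_space set"
  assumes "closed F" "F \<noteq> {}" "\<And>p. \<bar>u p\<bar> = infdist p F"
  shows "unit_slope_off u F"
  unfolding unit_slope_off_def
proof (intro allI impI)
  fix p assume "p \<notin> F"
  then have "infdist p F > 0"
    using assms by (simp add: infdist_pos_not_in_closed)
  moreover have "\<exists>q. dist p q = s \<and> s \<le> \<bar>u q - u p\<bar>" if s: "0 < s \<and> s < infdist p F" for s
  proof -
    obtain q where "dist p q = s" "infdist q F = infdist p F - s"
      using infdist_toward_nearest[of F p s] assms(1,2) \<open>p \<notin> F\<close> s by blast
    then show ?thesis
      using assms(3)[of p] assms(3)[of q] by (intro exI[of _ q]) linarith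
  qed
  ultimately show "\<exists>\<rho>>0. \<forall>s. 0 < s \<and> s < \<rho> \<longrightarrow> (\<exists>q. dist p q = s \<and> s \<le> \<bar>u q - u p\<bar>)"
    by blast
qed

text \<open>\<open>K\<close> below is the Voronoi cell of \<open>q\<close> against \<open>F\<close>.
  It is convex, being an intersection of half-spaces, and the equidistant points lie on its
  frontier, which is null. This settles the parameter 1/2 when the inner set is empty.\<close>

lemma negligible_equidistant:
  fixes F :: "'a::euclidean_space set"
  assumes "closed F" "F \<noteq> {}" "q \<notin> F"
  shows "negligible {p. infdist p F = dist p q}"
proof -
  define K where "K = (\<Inter>a\<in>F. {p. dist p q \<le> dist p a})"
  have hs: "{p. dist p q \<le> dist p a} = {p. (2 *\<^sub>R (a - q)) \<bullet> p \<le> a \<bullet> a - q \<bullet> q}" for a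
    by (auto simp: dist_norm norm_le algebra_simps inner_commute)
  have "convex K"
    unfolding K_def hs by (intro convex_INT convex_halfspace_le)
  moreover have "{p. infdist p F = dist p q} \<subseteq> frontier K"
  proof clarify
    fix p assume p: "infdist p F = dist p q"
    obtain a where a: "a \<in> F" "infdist p F = dist p a"
      using infdist_attains_inf[OF assms(1,2)] by metis
    have "p \<in> K"
      unfolding K_def using p by (auto intro: infdist_le simp flip: p)
    moreover have "p \<notin> interior K"
    proof
      assume "p \<in> interior K"
      moreover have "interior K \<subseteq> interior {p. (2 *\<^sub>R (a - q)) \<bullet> p \<le> a \<bullet> a - q \<bullet> q}"
        using a(1) unfolding K_def hs[symmetric] by (intro interior_mono) auto
      ultimately have "(2 *\<^sub>R (a - q)) \<bullet> p < a \<bullet> a - q \<bullet> q"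
        using assms a(1) by (subst (asm) interior_halfspace_le) auto
      moreover have "dist p a \<le> dist p q"
        using p a by simp
      then have "(2 *\<^sub>R (a - q)) \<bullet> p \<ge> a \<bullet> a - q \<bullet> q"
        by (simp add: dist_norm norm_le algebra_simps inner_commute)
      ultimately show False
        by simp
    qed
    ultimately show "p \<in> frontier K"
      using closure_subset by (auto simp: frontier_def)
  qed
  ultimately show ?thesis
    using negligible_convex_frontier negligible_subset by blast
qed

text \<open>Dominated convergence with bound \<open>indicat_real M\<close>: away from the null zero
  set of \<open>F a\<close>, the sign of \<open>F x p\<close> is constant for \<open>x\<close> close
  to \<open>a\<close>.\<close>

lemma continuous_on_measure_superlevel:
  fixes F :: "real \<Rightarrow> 'a::euclidean_space \<Rightarrow> real"
  assumes M: "M \<in> lmeasurable"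
    and cont: "\<And>x. x \<in> S \<Longrightarrow> continuous_on UNIV (F x)"
    and contx: "\<And>p. continuous_on UNIV (\<lambda>x. F x p)"
    and null: "\<And>x. x \<in> S \<Longrightarrow> negligible ({p. F x p = 0} \<inter> M)"
  shows "continuous_on S (\<lambda>x. measure lebesgue ({p. F x p \<ge> 0} \<inter> M))"
  unfolding continuous_on_sequentially comp_def
proof clarify
  fix X :: "nat \<Rightarrow> real" and a assume a: "a \<in> S" and XS: "\<forall>n. X n \<in> S" and lim: "X \<longlonglongrightarrow> a"
  have sets: "{p. F x p \<ge> 0} \<inter> M \<in> sets lebesgue" if "x \<in> S" for x
  proof -
    have "closed {p. 0 \<le> F x p}"
      using cont[OF that] by (intro closed_Collect_le) auto
    then show ?thesis
      using M by (auto intro!: sets.Int dest: fmeasurableD)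
  qed
  let ?E = "\<lambda>x. {p. F x p \<ge> 0} \<inter> M"
  have "(\<lambda>n. integral\<^sup>L lebesgue (indicat_real (?E (X n)))) \<longlonglongrightarrow> integral\<^sup>L lebesgue (indicat_real (?E a))"
  proof (rule integral_dominated_convergence[where w = "indicat_real M"])
    show "indicat_real (?E a) \<in> borel_measurable lebesgue"
      "\<And>n. indicat_real (?E (X n)) \<in> borel_measurable lebesgue"
      using sets a XS by auto
    show "integrable lebesgue (indicat_real M)"
      using M by (simp add: lmeasurable_iff_integrable)
    show "AE p in lebesgue. norm (indicat_real (?E (X n)) p) \<le> indicat_real M p" for n
      by (rule AE_I2) (auto simp: indicator_def)
    show "AE p in lebesgue. (\<lambda>n. indicat_real (?E (X n)) p) \<longlonglongrightarrow> indicat_real (?E a) p"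
    proof (rule AE_I')
      show "{p. F a p = 0} \<inter> M \<in> null_sets lebesgue"
        using null[OF a] by (simp add: negligible_iff_null_sets)
      have "(\<lambda>n. indicat_real (?E (X n)) p) \<longlonglongrightarrow> indicat_real (?E a) p"
        if "p \<notin> {p. F a p = 0} \<inter> M" for p
      proof (cases "p \<in> M")
        case True
        have conv: "(\<lambda>n. F (X n) p) \<longlonglongrightarrow> F a p"
          by (rule continuous_on_tendsto_compose[OF contx[of p] lim]) auto
        moreover have "F a p \<noteq> 0"
          using that True by auto
        ultimately have "\<forall>\<^sub>F n in sequentially. (F (X n) p \<ge> 0) = (F a p \<ge> 0)"
          using order_tendstoD[OF conv, of 0]
          by (cases "F a p > 0") (auto elim!: eventually_mono)
        then show ?thesis
          by (intro tendsto_eventually) (erule eventually_mono, simp add: indicator_def)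
      qed auto
      then show "{p \<in> space lebesgue. \<not> (\<lambda>n. indicat_real (?E (X n)) p) \<longlonglongrightarrow> indicat_real (?E a) p}
          \<subseteq> {p. F a p = 0} \<inter> M"
        by blast
    qed
  qed
  then show "(\<lambda>n. measure lebesgue (?E (X n))) \<longlonglongrightarrow> measure lebesgue (?E a)"
    by simp
qed

section \<open>Signed distances\<close>

text \<open>If \<open>a\<close> is not itself a frontier point, then \<open>p\<close> and
  \<open>a\<close> are on different sides of \<open>S\<close> and the segment between them crosses
  the frontier.\<close>

lemma infdist_frontier_le:
  fixes S :: "'a::euclidean_space set"
  assumes "(p \<in> S \<and> a \<notin> interior S) \<or> (p \<notin> S \<and> a \<in> closure S)"
  shows "infdist p (frontier S) \<le> dist p a"
proof (cases "a \<in> frontier S")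
  case False
  then have "(p \<in> S) \<noteq> (a \<in> S)"
    using assms closure_subset[of S] interior_subset[of S] unfolding frontier_def by blast
  then have "closed_segment p a \<inter> S \<noteq> {}" "closed_segment p a - S \<noteq> {}"
    by auto
  then obtain z where "z \<in> closed_segment p a" "z \<in> frontier S"
    using connected_Int_frontier[of "closed_segment p a" S] by auto
  then show ?thesis
    using infdist_le[of z "frontier S" p] dist_in_closed_segment(1)[of z p a]
    by (simp add: dist_commute)
qed (rule infdist_le)

lemma abs_sdist: "\<bar>sdist A p\<bar> = infdist p (frontier A)"
  by (simp add: sdist_def infdist_nonneg)

text \<open>Points on the same side inherit the bound from \<open>infdist\<close>. For points on
  opposite sides, a frontier point on the segment splits \<open>dist p q\<close> into two parts that
  bound the two distances separately.\<close>

lemma sdist_lipschitz: "\<bar>sdist A p - sdist A q\<bar> \<le> dist p q"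
proof -
  have "infdist x (frontier A) + infdist y (frontier A) \<le> dist x y" if "x \<in> A" "y \<notin> A" for x y
  proof -
    have "closed_segment x y \<inter> A \<noteq> {}" "closed_segment x y - A \<noteq> {}"
      using that by auto
    then obtain z where z: "z \<in> closed_segment x y" "z \<in> frontier A"
      using connected_Int_frontier[of "closed_segment x y" A] by auto
    have "infdist x (frontier A) + infdist y (frontier A) \<le> dist x z + dist z y"
      using z(2) by (intro add_mono) (auto intro: infdist_le simp: dist_commute)
    also have "\<dots> = dist x y"
      using z(1) by (simp add: between_mem_segment[symmetric] between)
    finally show ?thesis .
  qed
  note cross = this[of p q] this[of q p, unfolded dist_commute[of q p]]
  have "0 \<le> infdist p (frontier A)" "0 \<le> infdist q (frontier A)"
    by (rule infdist_nonneg)+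
  then show ?thesis
    using cross infdist_triangle_abs[of p "frontier A" q]
    by (cases "p \<in> A"; cases "q \<in> A") (simp_all add: sdist_def abs_le_iff)
qed

lemma continuous_on_sdist [continuous_intros]: "continuous_on S (sdist A)"
  by (rule lipschitz_on_continuous_on[of 1], rule lipschitz_onI)
    (auto simp: dist_real_def sdist_lipschitz)

lemma frontier_nonempty_bounded:
  fixes A :: "'a::euclidean_space set"
  shows "bounded A \<Longrightarrow> A \<noteq> {} \<Longrightarrow> frontier A \<noteq> {}"
  using frontier_eq_empty not_bounded_UNIV by blast

text \<open>The closure appears because frontier points outside \<open>A\<close> also have signed
  distance 0.\<close>

lemma sdist_nonneg_iff:
  assumes "frontier A \<noteq> {}"
  shows "sdist A p \<ge> 0 \<longleftrightarrow> p \<in> closure A"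
proof -
  have "infdist p (frontier A) = 0 \<longleftrightarrow> p \<in> frontier A"
    using in_closure_iff_infdist_zero[OF assms, of p] by simp
  then show ?thesis
    using infdist_nonneg[of p "frontier A"] closure_subset[of A] interior_subset[of A]
    by (auto simp: sdist_def frontier_def)
qed

lemma sdist_eq_0_iff:
  assumes "frontier A \<noteq> {}"
  shows "sdist A p = 0 \<longleftrightarrow> p \<in> frontier A"
  using in_closure_iff_infdist_zero[OF assms, of p] by (simp add: sdist_def)

text \<open>For \<open>p\<close> in \<open>B\<close>, a frontier point of \<open>A\<close> is not
  interior to \<open>B\<close>, so the frontier of \<open>B\<close> is at least as near. Outside
  \<open>A\<close> the roles are exchanged, and for \<open>p\<close> in \<open>A - B\<close> the
  signs decide.\<close>

lemma sdist_mono: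
  assumes "B \<subseteq> A" "frontier A \<noteq> {}" "frontier B \<noteq> {}"
  shows "sdist B p \<le> sdist A p"
proof -
  obtain a where a: "a \<in> frontier A" "infdist p (frontier A) = dist p a"
    using infdist_attains_inf[OF frontier_closed assms(2)] by metis
  obtain b where b: "b \<in> frontier B" "infdist p (frontier B) = dist p b"
    using infdist_attains_inf[OF frontier_closed assms(3)] by metis
  have "infdist p (frontier B) \<le> infdist p (frontier A)" if "p \<in> B"
    using that a infdist_frontier_le[of p B a] interior_mono[OF assms(1)]
    by (auto simp: frontier_def)
  moreover have "infdist p (frontier A) \<le> infdist p (frontier B)" if "p \<notin> A"
    using that b infdist_frontier_le[of p A b] closure_mono[OF assms(1)]
    by (auto simp: frontier_def)
  ultimately show ?thesis
    using assms(1) infdist_nonneg[of p "frontier A"] infdist_nonneg[of p "frontier B"]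
    by (auto simp: sdist_def)
qed

lemma unit_slope_off_sdist:
  "frontier A \<noteq> {} \<Longrightarrow> unit_slope_off (sdist A) (frontier A)"
  by (intro unit_slope_off_abs_infdist abs_sdist) auto

lemma sdist_singleton: "sdist {q} p = - norm (p - q)"
  by (simp add: sdist_def infdist_singleton dist_norm frontier_def)

section \<open>Distance averages of a nested pair\<close>

locale nested_pair =
  fixes A B :: "'a::euclidean_space set"
  assumes jordan_A: "jordan A" and jordan_B: "jordan B"
    and sub: "B \<subseteq> A" and B_ne: "B \<noteq> {}" and closed_B: "closed B"
begin

definition f :: "real \<Rightarrow> 'a \<Rightarrow> real" where
  "f x p = x * sdist A p + (1 - x) * sdist B p"

definition E :: "real \<Rightarrow> 'a set" where
  "E x = {p. f x p \<ge> 0}"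

definition h :: "real \<Rightarrow> real" where
  "h x = measure lebesgue (E x)"

definition null_level :: "real \<Rightarrow> bool" where
  "null_level x \<longleftrightarrow> negligible {p. f x p = 0}"

lemma frontier_A_ne: "frontier A \<noteq> {}" and frontier_B_ne: "frontier B \<noteq> {}"
  using frontier_nonempty_bounded jordan_A jordan_B sub B_ne unfolding jordan_def by auto

lemma f_mono: "x \<le> y \<Longrightarrow> f x p \<le> f y p"
proof -
  assume "x \<le> y"
  have "f y p - f x p = (y - x) * (sdist A p - sdist B p)"
    by (simp add: f_def algebra_simps)
  also have "\<dots> \<ge> 0"
    using \<open>x \<le> y\<close> sdist_mono[OF sub frontier_A_ne frontier_B_ne] by simp
  finally show ?thesis
    by simp
qed

lemma E_mono: "x \<le> y \<Longrightarrow> E x \<subseteq> E y"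
  unfolding E_def using f_mono order_trans by blast

lemma continuous_f: "continuous_on UNIV (f x)"
  unfolding f_def by (intro continuous_intros)

lemma closed_E: "closed (E x)"
  unfolding E_def using continuous_f by (intro closed_Collect_le) auto

lemma E_0: "E 0 = B"
  using sdist_nonneg_iff[OF frontier_B_ne] closed_B by (auto simp: E_def f_def)

lemma E_1: "E 1 = closure A"
  using sdist_nonneg_iff[OF frontier_A_ne] by (auto simp: E_def f_def)

text \<open>Enlarge \<open>x\<close> to \<open>y \<ge> 1\<close>, so that \<open>y\<close> and
  \<open>y - 1\<close> are nonnegative. Far out \<open>sdist A p\<close> is at most
  \<open>R - norm p\<close>, while \<open>sdist B p\<close> is at least
  \<open>sdist B 0 - norm p\<close>; as the weights add up to 1, \<open>f y p\<close> is at most a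
  constant minus \<open>norm p\<close>.\<close>

lemma bounded_E: "bounded (E x)"
proof -
  define y where "y = max x 1"
  obtain R where R: "A \<subseteq> cball 0 R"
    using jordan_A unfolding jordan_def bounded_iff by (force simp: dist_norm)
  then have cl: "closure A \<subseteq> cball 0 R"
    by (simp add: closure_minimal)
  have "E y \<subseteq> cball 0 (R + \<bar>y * R - (y - 1) * sdist B 0\<bar>)"
  proof
    fix p assume "p \<in> E y"
    then have fy: "f y p \<ge> 0"
      by (simp add: E_def)
    show "p \<in> cball 0 (R + \<bar>y * R - (y - 1) * sdist B 0\<bar>)"
    proof (cases "norm p \<le> R")
      case False
      then have "p \<notin> A"
        using R by auto
      obtain a where a: "a \<in> frontier A" "infdist p (frontier A) = dist p a"
        using infdist_attains_inf[OF frontier_closed frontier_A_ne] by metis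
      have "norm a \<le> R"
        using a(1) cl by (auto simp: frontier_def)
      then have "norm p - R \<le> dist p a"
        using norm_triangle_ineq2[of p a] by (simp add: dist_norm)
      then have "sdist A p \<le> R - norm p"
        using \<open>p \<notin> A\<close> a by (simp add: sdist_def)
      then have "y * sdist A p \<le> y * (R - norm p)"
        by (intro mult_left_mono) (auto simp: y_def)
      moreover have "(y - 1) * sdist B p \<ge> (y - 1) * (sdist B 0 - norm p)"
        using sdist_lipschitz[of B 0 p] by (intro mult_left_mono) (auto simp: y_def)
      ultimately have "f y p \<le> y * R - (y - 1) * sdist B 0 - norm p"
        by (simp add: f_def algebra_simps)
      moreover have "R \<ge> 0"
        using R sub B_ne by (metis cball_eq_empty linorder_not_less subset_empty)
      ultimately show ?thesis
        using fy by simp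
    qed auto
  qed
  then have "bounded (E y)"
    using bounded_cball bounded_subset by blast
  moreover have "E x \<subseteq> E y"
    by (rule E_mono) (simp add: y_def)
  ultimately show ?thesis
    by (rule bounded_subset)
qed

lemma E_lmeasurable: "E x \<in> lmeasurable"
  by (intro lmeasurable_compact) (simp add: compact_eq_bounded_closed bounded_E closed_E)

lemma h_mono: "x \<le> y \<Longrightarrow> h x \<le> h y"
  unfolding h_def by (rule measure_mono_fmeasurable[OF E_mono fmeasurableD[OF E_lmeasurable] E_lmeasurable])

lemma h_0: "h 0 = measure lebesgue B"
  by (simp add: h_def E_0)

lemma measure_closure_A: "measure lebesgue (closure A) = measure lebesgue A"
proof (rule measure_negligible_symdiff)
  show "A \<in> lmeasurable"
    using jordan_A by (rule jordan_lmeasurable)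
  have "(A - closure A) \<union> (closure A - A) \<subseteq> frontier A"
    using closure_subset interior_subset unfolding frontier_def by blast
  then show "negligible ((A - closure A) \<union> (closure A - A))"
    using jordan_A unfolding jordan_def by (auto intro: negligible_subset)
qed

lemma h_1: "h 1 = measure lebesgue A"
  by (simp add: h_def E_1 measure_closure_A)

text \<open>Away from 1/2 one of the weights \<open>x\<close> and \<open>1 - x\<close> is strictly
  larger in absolute value, and the signed distance carrying it takes the part of \<open>u\<close>
  in \<open>negligible_level_set\<close>.\<close>

lemma null_level_not_half:
  assumes "x \<noteq> 1/2"
  shows "null_level x"
proof (cases "\<bar>1 - x\<bar> < \<bar>x\<bar>")
  case True
  have "negligible {p. x * sdist A p + (1 - x) * sdist B p + 0 = 0}"
    using True jordan_A unfolding jordan_def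
    by (intro negligible_level_set[where Z = "frontier A"] sdist_lipschitz frontier_closed
        unit_slope_off_sdist[OF frontier_A_ne]) auto
  then show ?thesis
    by (simp add: null_level_def f_def)
next
  case False
  have "negligible {p. (1 - x) * sdist B p + x * sdist A p + 0 = 0}"
    using False assms jordan_B unfolding jordan_def
    by (intro negligible_level_set[where Z = "frontier B"] sdist_lipschitz frontier_closed
        unit_slope_off_sdist[OF frontier_B_ne]) auto
  then show ?thesis
    by (simp add: null_level_def f_def add.commute)
qed

text \<open>Intersecting with \<open>E d\<close>, the largest set for parameters in the interval,
  supplies the dominating set of finite measure and leaves each \<open>E x\<close>
  unchanged.\<close>

lemma continuous_on_h:
  assumes null: "\<And>x. x \<in> {c..d} \<Longrightarrow> null_level x"
  shows "continuous_on {c..d} h"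
proof -
  have "continuous_on {c..d} (\<lambda>x. measure lebesgue ({p. f x p \<ge> 0} \<inter> E d))"
  proof (rule continuous_on_measure_superlevel)
    show "E d \<in> lmeasurable"
      by (rule E_lmeasurable)
    show "continuous_on UNIV (\<lambda>x. f x p)" for p
      unfolding f_def by (intro continuous_intros)
    show "negligible ({p. f x p = 0} \<inter> E d)" if "x \<in> {c..d}" for x
      using null[OF that] by (auto simp: null_level_def intro: negligible_Int)
  qed (rule continuous_f)
  moreover have "measure lebesgue ({p. f x p \<ge> 0} \<inter> E d) = h x" if "x \<in> {c..d}" for x
  proof -
    have "{p. f x p \<ge> 0} \<inter> E d = E x"
      using E_mono[of x d] that by (auto simp: E_def)
    then show ?thesis
      by (simp add: h_def)
  qed
  ultimately show ?thesis
    by (metis (no_types, lifting) continuous_on_cong)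
qed

lemma jordan_E:
  assumes "null_level x"
  shows "jordan (E x)"
proof -
  have "open {p. f x p > 0}"
    using continuous_f by (intro open_Collect_less) auto
  then have "{p. f x p > 0} \<subseteq> interior (E x)"
    by (intro interior_maximal) (auto simp: E_def)
  then have "frontier (E x) \<subseteq> {p. f x p = 0}"
    using closed_E[of x] by (force simp: frontier_def E_def closure_closed)
  then show ?thesis
    using assms bounded_E by (auto simp: jordan_def null_level_def intro: negligible_subset)
qed

lemma ci_E_eq: "h x = h y \<Longrightarrow> ci (E x) = ci (E y)"
proof (induction x y rule: linorder_wlog)
  case (le x y)
  then show ?case
    using ci_eq_of_measure_le_closed[OF E_mono[OF le(1)] closed_E E_lmeasurable E_lmeasurable]
    by (simp add: h_def)
qed simp

text \<open>The best approximation of a target value by \<open>h\<close> on \<open>{-N..N}\<close> is its projection to the range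
  of \<open>h\<close>. It is attained at some \<open>g\<^sub>0\<close> with null level set; every other optimal \<open>g\<close> may
  fail that, but has the same \<open>ci (E g)\<close>.\<close>

lemma optimal_parameter:
  assumes N: "-N \<le> c" "c \<le> d" "d \<le> N"
    and null: "\<And>x. x \<in> {c..d} \<Longrightarrow> null_level x"
    and m: "m = min (h N) (max (h (-N)) \<tau>)" "h c \<le> m" "m \<le> h d"
    and g: "g = (SOME g. g \<in> {-N..N} \<and> \<bar>h g - \<tau>\<bar> = (INF \<xi>\<in>{-N..N}. \<bar>h \<xi> - \<tau>\<bar>))"
  obtains g\<^sub>0 where "g\<^sub>0 \<in> {c..d}" "ci (E g) = ci (E g\<^sub>0)" "h g\<^sub>0 = m"
proof -
  have "continuous_on {c..d} h"
    using null by (rule continuous_on_h)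
  then obtain g\<^sub>0 where g0: "g\<^sub>0 \<in> {c..d}" "h g\<^sub>0 = m"
    using IVT'[of h c m d] m(2,3) N(2) by auto
  have range: "h (-N) \<le> h \<xi>" "h \<xi> \<le> h N" if "\<xi> \<in> {-N..N}" for \<xi>
    using that h_mono by auto
  have inf: "(INF \<xi>\<in>{-N..N}. \<bar>h \<xi> - \<tau>\<bar>) = \<bar>m - \<tau>\<bar>"
  proof (rule cInf_eq_minimum)
    show "\<bar>m - \<tau>\<bar> \<in> (\<lambda>\<xi>. \<bar>h \<xi> - \<tau>\<bar>) ` {-N..N}"
      using g0 N by (intro image_eqI[of _ _ g\<^sub>0]) auto
    show "\<bar>m - \<tau>\<bar> \<le> y" if "y \<in> (\<lambda>\<xi>. \<bar>h \<xi> - \<tau>\<bar>) ` {-N..N}" for y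
      using that range m(1) by (fastforce simp: min_def max_def abs_if)
  qed
  have "g\<^sub>0 \<in> {-N..N} \<and> \<bar>h g\<^sub>0 - \<tau>\<bar> = (INF \<xi>\<in>{-N..N}. \<bar>h \<xi> - \<tau>\<bar>)"
    using g0 N by (simp add: inf)
  then have "g \<in> {-N..N} \<and> \<bar>h g - \<tau>\<bar> = \<bar>m - \<tau>\<bar>"
    unfolding g inf by (rule someI)
  then have "h g = m"
    using range[of g] m(1) by (auto simp: min_def max_def abs_if split: if_splits)
  then show ?thesis
    using that g0 ci_E_eq by metis
qed

end

text \<open>The conditions passed from Step 1 to Step 2. Monotonicity in the parameter will keep the
  averages between the two given sets on [0,1].\<close>

definition monotone_interpolation :: "(real \<Rightarrow> 'a::euclidean_space set) \<Rightarrow> 'a set \<Rightarrow> 'a set \<Rightarrow> bool" where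
  "monotone_interpolation R B A \<longleftrightarrow> (\<forall>t. R t \<in> Jn) \<and> R 0 = B \<and> R 1 = A \<and>
    (\<forall>s t. s \<le> t \<longrightarrow> R s \<subseteq> R t) \<and>
    (\<forall>s t. dmu (R s) (R t) \<le> \<bar>t - s\<bar> * (measure lebesgue A - measure lebesgue B))"

text \<open>In a chain of Jordan sets, comparing measures decides inclusion after \<open>ci\<close>.
  So \<open>R t\<close> depends only on \<open>m t\<close>, the end values are recognized by their
  measures, and \<open>dmu\<close> becomes a difference of values of \<open>m\<close>.\<close>

lemma monotone_interpolation_of_chain:
  assumes chain: "\<And>F G. F \<in> \<C> \<Longrightarrow> G \<in> \<C> \<Longrightarrow> F \<subseteq> G \<or> G \<subseteq> F"
    and jordan: "\<And>F. F \<in> \<C> \<Longrightarrow> jordan F"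
    and R: "\<And>t. \<exists>F\<in>\<C>. R t = ci F \<and> measure lebesgue F = m t"
    and ends: "B \<in> \<C>" "A \<in> \<C>" "m 0 = measure lebesgue B" "m 1 = measure lebesgue A"
    and mono: "\<And>s t. s \<le> t \<Longrightarrow> m s \<le> m t"
    and lip: "\<And>s t. s \<le> t \<Longrightarrow> m t - m s \<le> (t - s) * (measure lebesgue A - measure lebesgue B)"
  shows "monotone_interpolation R (ci B) (ci A)"
proof -
  have sub: "ci F \<subseteq> ci G" if "F \<in> \<C>" "G \<in> \<C>" "measure lebesgue F \<le> measure lebesgue G" for F G
    using chain[OF that(1,2)] ci_eq_of_measure_le_jordan[of G F] jordan that ci_mono by blast
  have incl: "R s \<subseteq> R t" if "s \<le> t" for s t
    using R[of s] R[of t] mono[OF that] sub by metis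
  have Jn: "R t \<in> Jn" for t
    using R[of t] jordan ci_in_Jn by metis
  have meas: "measure lebesgue (R t) = m t" for t
    using R[of t] jordan measure_ci by metis
  have le: "dmu (R s) (R t) \<le> (t - s) * (measure lebesgue A - measure lebesgue B)" if "s \<le> t" for s t
    using dmu_mono_eq[OF incl[OF that]] Jn lip[OF that]
    by (simp add: Jn_iff_jordan jordan_lmeasurable meas)
  have "dmu (R s) (R t) \<le> \<bar>t - s\<bar> * (measure lebesgue A - measure lebesgue B)" for s t
    using le[of s t] le[of t s] by (cases "s \<le> t") (auto simp: dmu_commute abs_if)
  moreover have "R 0 = ci B"
    using R[of 0] ends sub by (metis order_refl subset_antisym)
  moreover have "R 1 = ci A"
    using R[of 1] ends sub by (metis order_refl subset_antisym)
  moreover have "measure lebesgue (ci A) = measure lebesgue A" "measure lebesgue (ci B) = measure lebesgue B"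
    using jordan ends measure_ci by auto
  ultimately show ?thesis
    using incl Jn by (simp add: monotone_interpolation_def)
qed

section \<open>Step 1: clamped target values and the chain of averages\<close>

context nested_pair
begin

definition target :: "real \<Rightarrow> real" where
  "target t = t * measure lebesgue A + (1 - t) * measure lebesgue B"

definition clamp :: "real \<Rightarrow> real \<Rightarrow> real" where
  "clamp N t = min (h N) (max (h (-N)) (target t))"

lemma measure_B_le_A: "measure lebesgue B \<le> measure lebesgue A"
  using h_mono[of 0 1] by (simp add: h_0 h_1)

lemma target_diff: "target t - target s = (t - s) * (measure lebesgue A - measure lebesgue B)"
  by (simp add: target_def algebra_simps)

lemma target_mono: "s \<le> t \<Longrightarrow> target s \<le> target t"
  using target_diff[of t s] measure_B_le_A
    mult_nonneg_nonneg[of "t - s" "measure lebesgue A - measure lebesgue B"] by linarith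

lemma target_0: "target 0 = h 0" and target_1: "target 1 = h 1"
  by (simp_all add: target_def h_0 h_1)

lemma clamp_mono: "s \<le> t \<Longrightarrow> clamp N s \<le> clamp N t"
  using target_mono unfolding clamp_def by (intro min.mono max.mono) auto

text \<open>Projection to an interval does not increase distances. Outside [0,1] the clamped value
  may stop following the target, which is why only an inequality is claimed for arbitrary
  parameters.\<close>

lemma clamp_lipschitz:
  assumes "s \<le> t"
  shows "clamp N t - clamp N s \<le> (t - s) * (measure lebesgue A - measure lebesgue B)"
  using target_diff[of t s] target_mono[OF assms]
  unfolding clamp_def by (simp add: min_def max_def)

lemma clamp_eq_target:
  assumes "1 \<le> N" "t \<in> {0..1}"
  shows "clamp N t = target t"
  using assms h_mono[of 1 N] h_mono[of "-N" 0] target_mono[of 0 t] target_mono[of t 1]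
  by (simp add: clamp_def target_0 target_1)

text \<open>For \<open>t > 1\<close> the clamped target lies between \<open>h 1\<close> and
  \<open>h N\<close>, for \<open>t < 0\<close> between \<open>h (-N)\<close> and \<open>h 0\<close>;
  both parameter ranges avoid 1/2, so \<open>h\<close> is continuous there. The second conclusion
  keeps \<open>E g\<^sub>0\<close> comparable with the sets
  \<open>Onbhd B r \<inter> A\<close>.\<close>

lemma optimal_parameter_cases:
  assumes N: "1 \<le> N" and t: "null_level (1/2) \<or> t \<notin> {0..1}"
    and g: "g = (SOME g. g \<in> {-N..N} \<and>
      \<bar>h g - target t\<bar> = (INF \<xi>\<in>{-N..N}. \<bar>h \<xi> - target t\<bar>))"
  obtains g\<^sub>0 where "null_level g\<^sub>0" "null_level (1/2) \<or> g\<^sub>0 \<le> 0 \<or> g\<^sub>0 \<ge> 1"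
    "ci (E g) = ci (E g\<^sub>0)" "h g\<^sub>0 = clamp N t"
proof -
  have hN: "h (-N) \<le> h 0" "h 0 \<le> h 1" "h 1 \<le> h N"
    using N by (auto intro: h_mono)
  consider "t > 1" | "t < 0" | "t \<in> {0..1}" "null_level (1/2)"
    using t by fastforce
  then show ?thesis
  proof cases
    case 1
    then have "h 1 \<le> target t"
      using target_mono[of 1 t] by (simp add: target_1)
    then have "h 1 \<le> clamp N t" "clamp N t \<le> h N"
      using hN by (auto simp: clamp_def)
    then obtain g\<^sub>0 where "g\<^sub>0 \<in> {1..N}" "ci (E g) = ci (E g\<^sub>0)" "h g\<^sub>0 = clamp N t"
      using optimal_parameter[of N 1 N "clamp N t" "target t" g] N null_level_not_half g
      unfolding clamp_def by force
    then show ?thesis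
      using that null_level_not_half[of g\<^sub>0] by auto
  next
    case 2
    then have "target t \<le> h 0"
      using target_mono[of t 0] by (simp add: target_0)
    then have "h (-N) \<le> clamp N t" "clamp N t \<le> h 0"
      using hN by (auto simp: clamp_def)
    then obtain g\<^sub>0 where "g\<^sub>0 \<in> {-N..0}" "ci (E g) = ci (E g\<^sub>0)" "h g\<^sub>0 = clamp N t"
      using optimal_parameter[of N "-N" 0 "clamp N t" "target t" g] N null_level_not_half g
      unfolding clamp_def by force
    then show ?thesis
      using that null_level_not_half[of g\<^sub>0] by auto
  next
    case 3
    then have "h 0 \<le> clamp N t" "clamp N t \<le> h 1"
      using target_mono[of 0 t] target_mono[of t 1] clamp_eq_target[OF N, of t]
      by (auto simp: target_0 target_1)
    moreover have all: "null_level x" for x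
      using 3(2) null_level_not_half[of x] by metis
    ultimately obtain g\<^sub>0 where "ci (E g) = ci (E g\<^sub>0)" "h g\<^sub>0 = clamp N t"
      using optimal_parameter[of N 0 1 "clamp N t" "target t" g] N g
      unfolding clamp_def by force
    then show ?thesis
      using that all by auto
  qed
qed

lemma infdist_eq_infdist_frontier:
  assumes "p \<notin> B"
  shows "infdist p B = infdist p (frontier B)"
proof (rule antisym)
  obtain b where "b \<in> B" "infdist p B = dist p b"
    using infdist_attains_inf[OF closed_B B_ne] by metis
  then show "infdist p (frontier B) \<le> infdist p B"
    using infdist_frontier_le[of p B b] assms closure_subset by auto
  show "infdist p B \<le> infdist p (frontier B)"
    using closed_B frontier_B_ne by (intro infdist_mono) (auto simp: frontier_def)
qed

text \<open>Outside \<open>B\<close> the distance to \<open>B\<close> is minus the signed distance,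
  so this is a level of \<open>sdist B\<close> alone: weights 1 and 0, offset
  \<open>r\<close>.\<close>

lemma negligible_infdist_level:
  assumes "r > 0"
  shows "negligible {p. infdist p B = r}"
proof (rule negligible_subset)
  show "negligible {p. 1 * sdist B p + 0 * sdist B p + r = 0}"
    using jordan_B unfolding jordan_def
    by (intro negligible_level_set[where Z = "frontier B"] sdist_lipschitz frontier_closed
        unit_slope_off_sdist[OF frontier_B_ne]) auto
  show "{p. infdist p B = r} \<subseteq> {p. 1 * sdist B p + 0 * sdist B p + r = 0}"
  proof clarify
    fix p assume "r = infdist p B"
    moreover from this have "p \<notin> B"
      using assms by auto
    ultimately show "1 * sdist B p + 0 * sdist B p + infdist p B = 0"
      by (simp add: sdist_def infdist_eq_infdist_frontier)
  qed
qed

lemma Onbhd_0: "Onbhd B 0 = B"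
proof -
  have "infdist p B \<le> 0 \<longleftrightarrow> p \<in> B" for p
    using in_closure_iff_infdist_zero[OF B_ne, of p] closed_B infdist_nonneg[of p B]
    by (auto simp: antisym_conv)
  then show ?thesis
    by (simp add: Onbhd_def)
qed

lemma Onbhd_mono: "r \<le> r' \<Longrightarrow> Onbhd B r \<subseteq> Onbhd B r'"
  by (auto simp: Onbhd_def)

lemma jordan_Onbhd_Int:
  assumes "r \<ge> 0"
  shows "jordan (Onbhd B r \<inter> A)"
proof (cases "r = 0")
  case True
  then show ?thesis
    using jordan_B sub by (simp add: Onbhd_0 Int_absorb2)
next
  case False
  have cont: "continuous_on UNIV (\<lambda>p. infdist p B)"
    by (intro continuous_intros)
  have "closed (Onbhd B r)"
    unfolding Onbhd_def using cont by (intro closed_Collect_le) auto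
  moreover have "open {p. infdist p B < r}"
    using cont by (intro open_Collect_less) auto
  then have "{p. infdist p B < r} \<subseteq> interior (Onbhd B r)"
    by (intro interior_maximal) (auto simp: Onbhd_def)
  ultimately have "frontier (Onbhd B r) \<subseteq> {p. infdist p B = r}"
    by (force simp: frontier_def Onbhd_def closure_closed)
  then have "negligible (frontier (Onbhd B r))"
    using negligible_infdist_level[of r] assms False by (auto intro: negligible_subset)
  then show ?thesis
    using frontier_Int_subset[of "Onbhd B r" A] jordan_A unfolding jordan_def
    by (metis bounded_Int negligible_Un negligible_subset)
qed

lemma Onbhd_measure_attained:
  assumes "measure lebesgue B \<le> \<tau>" "\<tau> \<le> measure lebesgue A"
  shows "\<exists>r\<ge>0. measure lebesgue (Onbhd B r \<inter> A) = \<tau>"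
proof -
  obtain b where b: "b \<in> B"
    using B_ne by blast
  obtain R where R: "\<And>p. p \<in> A \<Longrightarrow> dist b p \<le> R"
    using jordan_A unfolding jordan_def bounded_any_center[of A b] by blast
  have R0: "R \<ge> 0"
    using R[of b] b sub by auto
  have AR: "Onbhd B R \<inter> A = A"
    using R infdist_le2[OF b] by (force simp: Onbhd_def dist_commute)
  have meas: "B \<in> lmeasurable" "A \<in> lmeasurable"
    using jordan_A jordan_B jordan_lmeasurable by auto
  \<comment> \<open>Only the part outside \<open>B\<close> is measured: at \<open>r = 0\<close> the
    zero set of the distance is \<open>B\<close>, which may have positive measure, but it does not
    meet \<open>A - B\<close>.\<close>
  define k where "k r = measure lebesgue ({p. r - infdist p B \<ge> 0} \<inter> (A - B))" for r
  have "continuous_on {0..R} k"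
    unfolding k_def
  proof (rule continuous_on_measure_superlevel)
    show "A - B \<in> lmeasurable"
      using jordan_A jordan_B jordan_Diff jordan_lmeasurable by blast
    show "negligible ({p. r - infdist p B = 0} \<inter> (A - B))" if "r \<in> {0..R}" for r
    proof (cases "r = 0")
      case True
      then have "{p. r - infdist p B = 0} \<inter> (A - B) = {}"
        using in_closure_iff_infdist_zero[OF B_ne] closed_B by auto
      then show ?thesis
        by (metis negligible_empty)
    next
      case False
      then have "negligible {p. infdist p B = r}"
        using that by (intro negligible_infdist_level) auto
      then show ?thesis
        by (rule negligible_subset) auto
    qed
  qed (intro continuous_intros)+
  moreover have split: "measure lebesgue (Onbhd B r \<inter> A) = k r + measure lebesgue B" if "r \<ge> 0" for r
  proof -
    have "Onbhd B r \<inter> A = B \<union> ({p. r - infdist p B \<ge> 0} \<inter> (A - B))"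
      using sub Onbhd_mono[OF that] by (auto simp: Onbhd_def Onbhd_0 that)
    moreover have "{p. r - infdist p B \<ge> 0} \<inter> (A - B) = (Onbhd B r \<inter> A) - B"
      by (auto simp: Onbhd_def)
    then have "{p. r - infdist p B \<ge> 0} \<inter> (A - B) \<in> lmeasurable"
      using jordan_Onbhd_Int[OF that] jordan_B jordan_Diff jordan_lmeasurable by metis
    ultimately show ?thesis
      using meas(1) by (subst \<open>Onbhd B r \<inter> A = _\<close>, subst measure_Un2)
        (auto simp: k_def intro!: arg_cong[where f = "measure lebesgue"])
  qed
  moreover have "k 0 = 0"
    using split[of 0] sub by (simp add: Onbhd_0 Int_absorb2)
  moreover have "k R + measure lebesgue B = measure lebesgue A"
    using split[OF R0] AR by simp
  ultimately obtain r where "r \<ge> 0" "k r = \<tau> - measure lebesgue B"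
    using IVT'[of k 0 "\<tau> - measure lebesgue B" R] assms R0 by auto
  then show ?thesis
    using split by auto
qed

lemma monotone_interpolation_step:
  assumes N: "1 \<le> N"
    and R1: "\<And>t. null_level (1/2) \<or> t \<notin> {0..1} \<Longrightarrow>
      R t = ci (E (SOME g. g \<in> {-N..N} \<and> \<bar>h g - target t\<bar> = (INF \<xi>\<in>{-N..N}. \<bar>h \<xi> - target t\<bar>)))"
    and R2: "\<And>t. \<not> null_level (1/2) \<Longrightarrow> t \<in> {0..1} \<Longrightarrow>
      R t = ci (Onbhd B (SOME r. r \<ge> 0 \<and> measure lebesgue (Onbhd B r \<inter> A) = target t) \<inter> A)"
  shows "monotone_interpolation R (ci B) (ci A)"
proof -
  define \<D> where "\<D> = {E x | x. null_level x \<and> (null_level (1/2) \<or> x \<le> 0 \<or> x \<ge> 1)}"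
  define \<O> where "\<O> = {Onbhd B r \<inter> A | r. r \<ge> 0 \<and> \<not> null_level (1/2)}"
  have "E x \<in> \<D>" if "x \<le> 0 \<or> x \<ge> 1" for x
    unfolding \<D>_def using that null_level_not_half[of x] by fastforce
  from this[of 0] this[of 1] have "E 0 \<in> \<D>" "E 1 \<in> \<D>"
    by simp_all
  then have E_in: "B \<in> \<D>" "closure A \<in> \<D>"
    by (simp_all add: E_0 E_1)
  have jordan: "jordan F" if "F \<in> \<D> \<union> \<O>" for F
    using that jordan_E jordan_Onbhd_Int by (auto simp: \<D>_def \<O>_def)
  have DD: "F \<subseteq> G \<or> G \<subseteq> F" if FG: "F \<in> \<D>" "G \<in> \<D>" for F G
  proof -
    obtain x y where "F = E x" "G = E y"
      using FG unfolding \<D>_def by blast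
    then show ?thesis
      using E_mono[of x y] E_mono[of y x] by (cases "x \<le> y") auto
  qed
  have OO: "F \<subseteq> G \<or> G \<subseteq> F" if FG: "F \<in> \<O>" "G \<in> \<O>" for F G
  proof -
    obtain r r' where "F = Onbhd B r \<inter> A" "G = Onbhd B r' \<inter> A"
      using FG unfolding \<O>_def by blast
    then show ?thesis
      using Onbhd_mono[of r r'] Onbhd_mono[of r' r] by (cases "r \<le> r'") auto
  qed
  have DO: "F \<subseteq> G \<or> G \<subseteq> F" if F: "F \<in> \<D>" and G: "G \<in> \<O>" for F G
  proof -
    obtain r where r: "r \<ge> 0" "G = Onbhd B r \<inter> A" "\<not> null_level (1/2)"
      using G unfolding \<O>_def by blast
    then obtain x where x: "F = E x" "x \<le> 0 \<or> x \<ge> 1"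
      using F unfolding \<D>_def by blast
    have "B \<subseteq> G"
      using Onbhd_mono[OF r(1)] sub r(2) by (simp add: Onbhd_0)
    moreover have "G \<subseteq> closure A"
      using r(2) closure_subset by auto
    moreover have "F \<subseteq> B \<or> closure A \<subseteq> F"
      using x E_mono[of x 0] E_mono[of 1 x] by (auto simp: E_0 E_1)
    ultimately show ?thesis
      by blast
  qed
  have R: "\<exists>F\<in>\<D> \<union> \<O>. R t = ci F \<and> measure lebesgue F = clamp N t" for t
  proof (cases "null_level (1/2) \<or> t \<notin> {0..1}")
    case True
    obtain g\<^sub>0 where "null_level g\<^sub>0" "null_level (1/2) \<or> g\<^sub>0 \<le> 0 \<or> g\<^sub>0 \<ge> 1"
      "R t = ci (E g\<^sub>0)" "h g\<^sub>0 = clamp N t"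
      using optimal_parameter_cases[OF N True refl] R1[OF True] by metis
    then show ?thesis
      by (intro bexI[of _ "E g\<^sub>0"]) (auto simp: \<D>_def h_def)
  next
    case False
    define r where "r = (SOME r. r \<ge> 0 \<and> measure lebesgue (Onbhd B r \<inter> A) = target t)"
    have "measure lebesgue B \<le> target t" "target t \<le> measure lebesgue A"
      using target_mono[of 0 t] target_mono[of t 1] False by (auto simp: target_0 target_1 h_0 h_1)
    then have "r \<ge> 0 \<and> measure lebesgue (Onbhd B r \<inter> A) = target t"
      unfolding r_def by (rule someI_ex[OF Onbhd_measure_attained])
    moreover have "clamp N t = target t"
      using False by (intro clamp_eq_target[OF N]) auto
    moreover have "R t = ci (Onbhd B r \<inter> A)"
      using R2 False unfolding r_def by blast
    ultimately show ?thesis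
      using False by (intro bexI[of _ "Onbhd B r \<inter> A"]) (auto simp: \<O>_def)
  qed
  \<comment> \<open>The chain contains \<open>E 1 = closure A\<close> in place of \<open>A\<close>;
    since \<open>A\<close> is Jordan, \<open>ci\<close> gives the same set for both.\<close>
  have "monotone_interpolation R (ci B) (ci (closure A))"
  proof (rule monotone_interpolation_of_chain[where \<C> = "\<D> \<union> \<O>" and m = "clamp N"])
    show "F \<subseteq> G \<or> G \<subseteq> F" if "F \<in> \<D> \<union> \<O>" "G \<in> \<D> \<union> \<O>" for F G
      using that DD[of F G] OO[of F G] DO[of F G] DO[of G F] by blast
    show "clamp N 0 = measure lebesgue B" "clamp N 1 = measure lebesgue (closure A)"
      using clamp_eq_target[OF N] by (simp_all add: target_0 target_1 h_0 h_1 measure_closure_A)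
    show "clamp N t - clamp N s \<le> (t - s) * (measure lebesgue (closure A) - measure lebesgue B)"
      if "s \<le> t" for s t
      using clamp_lipschitz[OF that] by (simp add: measure_closure_A)
  qed (use jordan R E_in clamp_mono in auto)
  moreover have "ci A = ci (closure A)"
    using jordan_A jordan_closure closure_subset measure_closure_A
    by (intro ci_eq_of_measure_le_jordan) auto
  ultimately show ?thesis
    by simp
qed

end

text \<open>This justifies the choice in \<open>center\<close>. As \<open>A\<close> need not be
  closed, the maximum is taken over the compact \<open>closure A\<close>; an interior point makes it
  positive, and a point with positive signed distance belongs to \<open>A\<close>.\<close>

lemma sdist_center_pos:
  assumes "jordan A" "measure lebesgue A > 0"
  shows "center A \<in> A \<and> sdist A (center A) > 0"
proof -
  have ne: "frontier A \<noteq> {}"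
    using assms frontier_nonempty_bounded[of A] unfolding jordan_def by force
  have "interior A \<noteq> {}"
  proof
    assume "interior A = {}"
    then have "A \<subseteq> frontier A"
      using closure_subset by (auto simp: frontier_def)
    then have "negligible A"
      using assms unfolding jordan_def by (auto intro: negligible_subset)
    then show False
      using assms by (simp add: negligible_imp_measure0)
  qed
  then obtain p where p: "p \<in> interior A"
    by blast
  have "compact (closure A)" "closure A \<noteq> {}"
    using assms p interior_subset by (auto simp: jordan_def compact_closure)
  then obtain q where q: "q \<in> closure A" "\<And>x. x \<in> closure A \<Longrightarrow> sdist A x \<le> sdist A q"
    using continuous_attains_sup[of "closure A" "sdist A"] continuous_on_sdist by blast
  have "p \<in> closure A" "p \<notin> frontier A"
    using p interior_subset closure_subset by (auto simp: frontier_def)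
  then have "sdist A p > 0"
    using sdist_nonneg_iff[OF ne, of p] sdist_eq_0_iff[OF ne, of p] by linarith
  then have pos: "sdist A q > 0"
    using q(2)[OF \<open>p \<in> closure A\<close>] by simp
  then have "q \<in> A"
    using infdist_nonneg[of q "frontier A"] by (auto simp: sdist_def split: if_splits)
  then have "\<exists>q. q \<in> A \<and> (\<forall>p\<in>A. sdist A p \<le> sdist A q)"
    using q closure_subset by blast
  then have "center A \<in> A \<and> (\<forall>p\<in>A. sdist A p \<le> sdist A (center A))"
    unfolding center_def by (rule someI_ex)
  then show ?thesis
    using pos \<open>q \<in> A\<close> by force
qed

text \<open>Shaped for outer sets \<open>B \<union> C\<close>: these are only Jordan, so the end
  value is \<open>ci A\<close>. The strict inequality gives \<open>A \<noteq> B\<close> and, for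
  empty \<open>B\<close>, a center with positive signed distance.\<close>

theorem monotone_interpolation_step1:
  fixes A B :: "'a::euclidean_space set"
  assumes N: "1 \<le> N" and A: "jordan A" and B: "B \<in> Jn" and sub: "B \<subseteq> A"
    and less: "measure lebesgue B < measure lebesgue A"
  shows "monotone_interpolation (\<lambda>t. step1 N t A B) B (ci A)"
proof -
  \<comment> \<open>The negated distance to a point is the signed distance of the singleton, so the empty
    inner set behaves like \<open>{center A}\<close>.\<close>
  define B\<^sub>0 where "B\<^sub>0 = (if B = {} then {center A} else B)"
  have center: "center A \<in> A" "sdist A (center A) > 0" if "B = {}"
    using sdist_center_pos[OF A] less that by auto
  have fs: "frontier {center A} = {center A}"
    by (simp add: frontier_def)
  have "jordan B\<^sub>0"
    using B by (auto simp: B\<^sub>0_def Jn_iff_jordan jordan_def fs)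
  moreover have "B\<^sub>0 \<subseteq> A" "B\<^sub>0 \<noteq> {}" "closed B\<^sub>0"
    using center sub Jn_closed[OF B] by (auto simp: B\<^sub>0_def)
  ultimately interpret nested_pair A B\<^sub>0
    using A by unfold_locales
  have mB: "measure lebesgue B\<^sub>0 = measure lebesgue B"
    by (auto simp: B\<^sub>0_def negligible_imp_measure0)
  have ciB: "ci B\<^sub>0 = B"
    using B by (auto simp: B\<^sub>0_def Jn_iff_jordan ci_def)
  have sd: "sdist2 A B = sdist B\<^sub>0"
    by (auto simp: sdist2_def B\<^sub>0_def sdist_singleton)
  have ne: "A \<noteq> {}" "A \<noteq> B"
    using less by auto
  have davg: "davg x A B = E x" for x
    using ne by (simp add: davg_def E_def f_def sd)
  have hfun: "hfun A B = h"
    by (auto simp: hfun_def h_def davg)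
  have level: "{p. sdist A p / 2 + sdist2 A B p / 2 = 0} = {p. f (1/2) p = 0}"
    by (simp add: f_def sd)
  \<comment> \<open>Since \<open>measure\<close> is 0 on sets of infinite measure too, the
    zero-measure condition means a null level set only once that set is known to be compact.\<close>
  have "{p. f (1/2) p = 0} \<subseteq> E (1/2)"
    by (auto simp: E_def)
  then have "bounded {p. f (1/2) p = 0}"
    using bounded_E bounded_subset by blast
  moreover have "closed {p. f (1/2) p = 0}"
    using continuous_closed_preimage_constant[of UNIV "f (1/2)" 0] continuous_f by simp
  ultimately have "{p. f (1/2) p = 0} \<in> lmeasurable"
    by (intro lmeasurable_compact) (simp add: compact_eq_bounded_closed)
  then have zm: "zero_measure_cond A B \<longleftrightarrow> null_level (1/2)"
    unfolding zero_measure_cond_def level null_level_def by (simp add: negligible_iff_measure)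
  \<comment> \<open>With an empty inner set the neighbourhood branch must be excluded:
    \<open>infdist p {}\<close> is 0 by convention, so \<open>Onbhd {} r\<close> would be the whole
    space for every \<open>r \<ge> 0\<close>.\<close>
  have null: "null_level (1/2)" if "B = {}"
    unfolding null_level_def
  proof (rule negligible_subset)
    let ?q = "center A"
    have "?q \<notin> frontier A"
      using center(2)[OF that] sdist_eq_0_iff[OF frontier_A_ne, of ?q] by auto
    then show "negligible {p. infdist p (frontier A) = dist p ?q}"
      by (intro negligible_equidistant frontier_A_ne) auto
    show "{p. f (1/2) p = 0} \<subseteq> {p. infdist p (frontier A) = dist p ?q}"
    proof clarify
      fix p assume "f (1/2) p = 0"
      then have "1/2 * sdist A p + (1 - 1/2) * sdist {?q} p = 0"
        using that unfolding f_def unfolding B\<^sub>0_def by simp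
      then have "sdist A p = dist p ?q"
        by (simp add: sdist_singleton dist_norm)
      then show "infdist p (frontier A) = dist p ?q"
        by (metis abs_of_nonneg abs_sdist zero_le_dist)
    qed
  qed
  have target: "target t = t * measure lebesgue A + (1 - t) * measure lebesgue B" for t
    by (simp add: target_def mB)
  have "monotone_interpolation (\<lambda>t. step1 N t A B) (ci B\<^sub>0) (ci A)"
  proof (rule monotone_interpolation_step[OF N])
    fix t
    show "step1 N t A B = ci (E (SOME g. g \<in> {-N..N} \<and>
        \<bar>h g - target t\<bar> = (INF \<xi>\<in>{-N..N}. \<bar>h \<xi> - target t\<bar>)))"
      if "null_level (1/2) \<or> t \<notin> {0..1}"
      using that ne(2) unfolding step1_def Let_def target zm davg hfun by simp
    show "step1 N t A B = ci (Onbhd B\<^sub>0 (SOME r. r \<ge> 0 \<and>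
        measure lebesgue (Onbhd B\<^sub>0 r \<inter> A) = target t) \<inter> A)"
      if "\<not> null_level (1/2)" "t \<in> {0..1}"
    proof -
      have "B\<^sub>0 = B"
        using null that(1) by (auto simp: B\<^sub>0_def)
      then show ?thesis
        using that ne(2) unfolding step1_def Let_def target zm by simp
    qed
  qed
  then show ?thesis
    by (simp add: ciB)
qed

section \<open>Components of the difference of a nested pair\<close>

text \<open>A point in the closure of the union but on neither frontier has a ball inside
  \<open>A - B\<close>. The ball is connected and meets some member, which then contains all of it.
  This works for infinite unions, hence for the merged small components.\<close>

lemma frontier_Union_components_subset:
  fixes A B :: "'a::euclidean_space set"
  assumes "\<D> \<subseteq> components (A - B)"
  shows "frontier (\<Union>\<D>) \<subseteq> frontier A \<union> frontier B"
proof
  fix p assume p: "p \<in> frontier (\<Union>\<D>)"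
  show "p \<in> frontier A \<union> frontier B"
  proof (rule ccontr)
    assume no: "p \<notin> frontier A \<union> frontier B"
    have U: "\<Union>\<D> \<subseteq> A - B"
      using assms in_components_subset by blast
    have pU: "p \<in> closure (\<Union>\<D>)" "p \<notin> interior (\<Union>\<D>)"
      using p by (auto simp: frontier_def)
    then have "p \<in> closure A"
      using U closure_mono[of "\<Union>\<D>" A] by blast
    moreover have "interior B \<inter> \<Union>\<D> = {}"
      using U interior_subset by blast
    then have "interior B \<inter> closure (\<Union>\<D>) = {}"
      by (simp only: open_Int_closure_eq_empty[OF open_interior])
    ultimately have "p \<in> interior A - closure B"
      using no pU(1) by (auto simp: frontier_def)
    moreover have "open (interior A - closure B)"
      by (intro open_Diff) auto
    ultimately obtain e where e: "e > 0" "ball p e \<subseteq> interior A - closure B"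
      by (meson open_contains_ball)
    then have eX: "ball p e \<subseteq> A - B"
      using interior_subset closure_subset by blast
    have "ball p e \<inter> closure (\<Union>\<D>) \<noteq> {}"
      using e(1) pU(1) by (meson centre_in_ball disjoint_iff)
    then have "ball p e \<inter> \<Union>\<D> \<noteq> {}"
      using open_Int_closure_eq_empty[OF open_ball, of p e "\<Union>\<D>"] by blast
    then obtain C where C: "C \<in> \<D>" "C \<inter> ball p e \<noteq> {}"
      by blast
    then have "ball p e \<subseteq> C"
      using components_maximal[of C "A - B" "ball p e"] assms eX by blast
    then have "ball p e \<subseteq> interior (\<Union>\<D>)"
      using C(1) by (intro interior_maximal) auto
    then show False
      using pU(2) e(1) by (meson centre_in_ball subsetD)
  qed
qed

lemma jordan_Union_components:
  assumes "jordan A" "jordan B" "\<D> \<subseteq> components (A - B)"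
  shows "jordan (\<Union>\<D>)"
proof -
  have "\<Union>\<D> \<subseteq> A"
    using assms(3) in_components_subset by blast
  then show ?thesis
    using frontier_Union_components_subset[OF assms(3)] assms(1,2) unfolding jordan_def
    by (meson bounded_subset negligible_Un negligible_subset)
qed

text \<open>Components need not have interior points, since infinitely many of them may accumulate at
  another one; but the complement of finitely many components is relatively open.\<close>

lemma negligible_cofinite_components:
  fixes A B :: "'a::euclidean_space set"
  assumes "ci A = A" "closed B" "\<D> \<subseteq> components (A - B)" "finite \<D>"
    and neg: "negligible (A - B - \<Union>\<D>)"
  shows "A - B - \<Union>\<D> = {}"
proof (rule ccontr)
  assume "A - B - \<Union>\<D> \<noteq> {}"
  then obtain p where p: "p \<in> A - B - \<Union>\<D>"
    by blast
  have "closedin (top_of_set (A - B)) (\<Union>\<D>)"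
    using assms closedin_component by (intro closedin_Union) auto
  then obtain T where T: "closed T" "\<Union>\<D> = (A - B) \<inter> T"
    unfolding closedin_closed by blast
  have V: "open (- T - B)"
    using T(1) assms(2) by (intro open_Diff) auto
  have "p \<in> - T - B" "p \<in> closure (interior A)"
    using p T(2) assms(1) unfolding ci_def by auto
  then have "(- T - B) \<inter> interior A \<noteq> {}"
    using open_Int_closure_eq_empty[OF V, of "interior A"] by blast
  moreover have "(- T - B) \<inter> interior A \<subseteq> A - B - \<Union>\<D>"
    using T(2) interior_subset by blast
  then have "negligible ((- T - B) \<inter> interior A)"
    using neg negligible_subset by blast
  ultimately show False
    using open_not_negligible[OF open_Int[OF V open_interior]] by blast
qed

lemma measure_pos_of_not_negligible:
  "jordan C \<Longrightarrow> \<not> negligible C \<Longrightarrow> measure lebesgue C > 0"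
  using jordan_lmeasurable[of C] by (simp add: negligible_iff_measure zero_less_measure_iff)

lemma finite_disjoint_large:
  assumes "\<epsilon> > 0" "X \<in> lmeasurable" "pairwise disjnt \<G>"
    and "\<And>C. C \<in> \<G> \<Longrightarrow> C \<in> lmeasurable \<and> C \<subseteq> X \<and> \<epsilon> \<le> measure lebesgue C"
  shows "finite \<G>"
proof -
  have "card \<H> \<le> nat \<lceil>measure lebesgue X / \<epsilon>\<rceil>" if "\<H> \<subseteq> \<G>" "finite \<H>" for \<H>
  proof -
    have "real (card \<H>) * \<epsilon> \<le> (\<Sum>C\<in>\<H>. measure lebesgue C)"
      using sum_bounded_below[of \<H> \<epsilon> "measure lebesgue"] that assms(4) by auto
    also have "\<dots> = measure lebesgue (\<Union>\<H>)"
      using that assms(4) pairwise_subset[OF assms(3) that(1)] by (intro measure_Union'[symmetric]) auto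
    also have "\<dots> \<le> measure lebesgue X"
      using that assms(2,4)
      by (intro measure_mono_fmeasurable fmeasurableD[OF fmeasurable.finite_Union]) auto
    finally have "real (card \<H>) \<le> measure lebesgue X / \<epsilon>"
      using assms(1) by (simp add: pos_le_divide_eq)
    then show ?thesis
      by linarith
  qed
  then show ?thesis
    using finite_if_finite_subsets_card_bdd by blast
qed

text \<open>Positive measure of every member is what makes \<open>B\<close> strictly smaller in
  measure than \<open>B \<union> C\<close>, as Step 1 requires. A single component may be null when
  there are infinitely many, but such components are merged.\<close>

lemma comp_family_props:
  fixes A B :: "'a::euclidean_space set"
  assumes \<epsilon>: "\<epsilon> > 0" and A: "A \<in> Jn" and B: "B \<in> Jn" and sub: "B \<subset> A"
  shows "finite (comp_family \<epsilon> A B)" "\<Union>(comp_family \<epsilon> A B) = A - B"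
    "pairwise disjnt (comp_family \<epsilon> A B)"
    "\<And>C. C \<in> comp_family \<epsilon> A B \<Longrightarrow> jordan C \<and> measure lebesgue C > 0"
proof -
  let ?X = "A - B"
  let ?cs = "components ?X"
  have jor: "jordan A" "jordan B" "ci A = A" "closed B"
    using A B Jn_closed by (auto simp: Jn_iff_jordan)
  have jC: "jordan C" if "C \<in> ?cs" for C
    using jordan_Union_components[OF jor(1,2), of "{C}"] that by simp
  have dis: "pairwise disjnt ?cs"
    using pairwise_disjoint_components[of ?X] unfolding pairwise_def disjnt_def .
  \<comment> \<open>Used twice: with finitely many components, each is what the others leave of
    \<open>A - B\<close>; with infinitely many, the merged set is what the finitely many large ones
    leave.\<close>
  have pos: "measure lebesgue (?X - \<Union>\<D>) > 0"
    if "\<D> \<subseteq> ?cs" "finite \<D>" "?X - \<Union>\<D> \<noteq> {}" for \<D>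
  proof (rule measure_pos_of_not_negligible)
    show "jordan (?X - \<Union>\<D>)"
      by (intro jordan_Diff jor(1,2) jordan_Union_components[OF jor(1,2) that(1)])
    show "\<not> negligible (?X - \<Union>\<D>)"
      using negligible_cofinite_components[OF jor(3,4) that(1,2)] that(3) by blast
  qed
  have "finite (comp_family \<epsilon> A B) \<and> \<Union>(comp_family \<epsilon> A B) = A - B \<and>
    pairwise disjnt (comp_family \<epsilon> A B) \<and>
    (\<forall>C\<in>comp_family \<epsilon> A B. jordan C \<and> measure lebesgue C > 0)"
  proof (cases "finite ?cs")
    case True
    have "measure lebesgue C > 0" if C: "C \<in> ?cs" for C
    proof -
      have "C \<inter> \<Union>(?cs - {C}) = {}"
        using dis C unfolding pairwise_def disjnt_def by blast
      moreover have "C \<union> \<Union>(?cs - {C}) = ?X"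
        using Union_components[of ?X] C by blast
      ultimately have "C = ?X - \<Union>(?cs - {C})"
        by blast
      then show ?thesis
        using pos[of "?cs - {C}"] True in_components_nonempty[OF C] by auto
    qed
    then show ?thesis
      using True jC dis by (simp add: comp_family_def)
  next
    case False
    define big where "big = {C\<in>?cs. measure lebesgue C \<ge> \<epsilon>}"
    define small where "small = {C\<in>?cs. measure lebesgue C < \<epsilon>}"
    have cs: "?cs = big \<union> small" "big \<inter> small = {}"
      by (auto simp: big_def small_def)
    have fin: "finite big"
    proof (rule finite_disjoint_large[OF \<epsilon>])
      show "?X \<in> lmeasurable"
        using jor jordan_Diff jordan_lmeasurable by blast
      show "pairwise disjnt big"
        using dis pairwise_subset cs by blast
      show "C \<in> lmeasurable \<and> C \<subseteq> ?X \<and> \<epsilon> \<le> measure lebesgue C" if "C \<in> big" for C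
        using that jC jordan_lmeasurable in_components_subset unfolding big_def by blast
    qed
    then have "small \<noteq> {}"
      using False cs by auto
    then have fam: "comp_family \<epsilon> A B = insert (\<Union>small) big"
      using False unfolding comp_family_def Let_def big_def[symmetric] small_def[symmetric] by simp
    have X: "\<Union>big \<union> \<Union>small = ?X"
      using Union_components[of ?X] cs by (metis Union_Un_distrib)
    have "disjnt C D" if "C \<in> big" "D \<in> small" for C D
    proof -
      have "C \<in> ?cs" "D \<in> ?cs" "C \<noteq> D"
        using that cs by auto
      then show ?thesis
        by (rule pairwiseD[OF dis])
    qed
    then have dj: "\<Union>big \<inter> \<Union>small = {}"
      by (auto simp: disjnt_iff)
    have "\<Union>small = ?X - \<Union>big"
      using X dj by blast
    moreover have "\<Union>small \<noteq> {}"
      using \<open>small \<noteq> {}\<close> in_components_nonempty cs by blast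
    ultimately have "measure lebesgue (\<Union>small) > 0"
      using pos[of big] fin cs by auto
    moreover have "jordan (\<Union>small)"
      using jordan_Union_components[OF jor(1,2)] cs by blast
    moreover have "jordan C \<and> measure lebesgue C > 0" if "C \<in> big" for C
      using that jC \<epsilon> by (auto simp: big_def)
    moreover have "pairwise disjnt (insert (\<Union>small) big)"
    proof (rule pairwise_insert[THEN iffD2], intro conjI allI impI)
      show "pairwise disjnt big"
        using dis pairwise_subset cs by blast
      show "disjnt (\<Union>small) C" "disjnt C (\<Union>small)" if "C \<in> big \<and> C \<noteq> \<Union>small" for C
        using dj that by (auto simp: disjnt_def)
    qed
    ultimately show ?thesis
      using fin X by (auto simp: fam)
  qed
  then show "finite (comp_family \<epsilon> A B)" "\<Union>(comp_family \<epsilon> A B) = A - B"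
    "pairwise disjnt (comp_family \<epsilon> A B)"
    "\<And>C. C \<in> comp_family \<epsilon> A B \<Longrightarrow> jordan C \<and> measure lebesgue C > 0"
    by auto
qed

section \<open>Averages of nested pairs\<close>

text \<open>Monotonicity is dropped and the difference of measures becomes \<open>dmu A B\<close>,
  so that the notion also fits pairs that are not nested.\<close>

definition interpolation :: "(real \<Rightarrow> 'a::euclidean_space set) \<Rightarrow> 'a set \<Rightarrow> 'a set \<Rightarrow> bool" where
  "interpolation S B A \<longleftrightarrow> (\<forall>t. S t \<in> Jn) \<and> S 0 = B \<and> S 1 = A \<and>
    (\<forall>s t. dmu (S s) (S t) \<le> \<bar>t - s\<bar> * dmu A B)"

text \<open>The family for \<open>C\<close> moves at speed at most the measure of \<open>C\<close>.
  The members are disjoint with union \<open>A - B\<close>, so these speeds sum to exactly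
  \<open>dmu A B\<close>.\<close>

theorem interpolation_step2:
  fixes A B :: "'a::euclidean_space set"
  assumes N: "1 \<le> N" and \<epsilon>: "\<epsilon> > 0" and A: "A \<in> Jn" and B: "B \<in> Jn" and sub: "B \<subset> A"
  shows "interpolation (\<lambda>t. step2 N \<epsilon> t A B) B A"
    and "t \<in> {0..1} \<Longrightarrow> B \<subseteq> step2 N \<epsilon> t A B \<and> step2 N \<epsilon> t A B \<subseteq> A"
proof -
  define F where "F = comp_family \<epsilon> A B"
  define R where "R C t = step1 N t (B \<union> C) B" for C t
  define S where "S t = step2 N \<epsilon> t A B" for t
  define L where "L = measure lebesgue A - measure lebesgue B"
  have F: "finite F" "\<Union>F = A - B" "pairwise disjnt F"
    and FC: "\<And>C. C \<in> F \<Longrightarrow> jordan C" "\<And>C. C \<in> F \<Longrightarrow> measure lebesgue C > 0"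
    using comp_family_props[OF \<epsilon> A B sub] unfolding F_def by blast+
  have jor: "jordan A" "jordan B" "ci A = A" "ci B = B"
    using A B by (auto simp: Jn_iff_jordan)
  have meas: "A \<in> lmeasurable" "B \<in> lmeasurable"
    using jor jordan_lmeasurable by auto
  have F_ne: "F \<noteq> {}"
    using F(2) sub by auto
  have CA: "B \<union> C \<subseteq> A" "B \<inter> C = {}" if "C \<in> F" for C
    using F(2) that sub by auto
  have mBC: "measure lebesgue (B \<union> C) = measure lebesgue B + measure lebesgue C" if "C \<in> F" for C
    using measure_Un2[OF meas(2) jordan_lmeasurable[OF FC(1)[OF that]]] CA(2)[OF that]
    by (simp add: Diff_triv Int_commute)
  have jBC: "jordan (B \<union> C)" if "C \<in> F" for C
    using jor FC that by (intro jordan_Un) auto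
  have mi: "monotone_interpolation (R C) B (ci (B \<union> C))" if "C \<in> F" for C
    unfolding R_def using FC(2)[OF that] mBC[OF that]
    by (intro monotone_interpolation_step1[OF N jBC[OF that] B]) auto
  have R: "R C t \<in> Jn" "R C 0 = B" "R C 1 = ci (B \<union> C)" "s \<le> t \<Longrightarrow> R C s \<subseteq> R C t"
    "dmu (R C s) (R C t) \<le> \<bar>t - s\<bar> * measure lebesgue C" if "C \<in> F" for C s t
    using mi[OF that] measure_ci[OF jBC[OF that]] mBC[OF that]
    unfolding monotone_interpolation_def by simp_all
  have RA: "R C t \<subseteq> A" if "C \<in> F" "t \<le> 1" for C t
    using R(4)[OF that] R(3)[OF that(1)] ci_mono[OF CA(1)[OF that(1)]] jor(3) by auto
  have Rm: "R C t \<in> lmeasurable" and Rj: "jordan (R C t)" if "C \<in> F" for C t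
    using R(1)[OF that] by (auto simp: Jn_iff_jordan jordan_lmeasurable)
  have L: "(\<Sum>C\<in>F. measure lebesgue C) = L"
  proof -
    have "(\<Sum>C\<in>F. measure lebesgue C) = measure lebesgue (\<Union>F)"
      using F(1,3) by (intro measure_Union'[symmetric]) (auto intro: jordan_lmeasurable FC(1))
    also have "\<dots> = L"
      using F(2) measurable_measure_Diff[OF meas(1) fmeasurableD[OF meas(2)]] sub by (simp add: L_def)
    finally show ?thesis .
  qed
  have sum_le: "(\<Sum>C\<in>F. dmu (R C s) (R C t)) \<le> \<bar>t - s\<bar> * L" for s t
    unfolding L[symmetric] sum_distrib_left using R(5) by (intro sum_mono) auto
  \<comment> \<open>Every \<open>R C 0\<close> equals \<open>B\<close>, so the intersection rule is
    also valid at 0 and the two half-lines can be glued there.\<close>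
  define S' where "S' t = ci (\<Inter>C\<in>F. R C t)" for t
  have S_pos: "S t = (\<Union>C\<in>F. R C t)" if "t \<ge> 0" for t
    using that sub by (auto simp: S_def step2_def R_def F_def)
  have S_neg: "S t = S' t" if "t < 0" for t
    using that sub by (auto simp: S_def S'_def step2_def R_def F_def)
  have S0: "S 0 = B"
    using F_ne R(2) by (simp add: S_pos)
  have "S' 0 = B"
    using F_ne R(2) jor(4) by (simp add: S'_def)
  then have S_nonpos: "S t = S' t" if "t \<le> 0" for t
    using that S_neg S0 by (cases "t = 0") auto
  have jINT: "jordan (\<Inter>C\<in>F. R C t)" for t
    using F(1) F_ne Rj by (rule jordan_INT)
  have Jn: "S t \<in> Jn" for t
    using UN_in_Jn[OF F(1), of "\<lambda>C. R C t"] R(1) ci_in_Jn[OF jINT, of t] S_pos[of t] S_neg[of t]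
    by (cases "t < 0") (auto simp: S'_def)
  have Sm: "S t \<in> lmeasurable" for t
    using Jn[of t] by (simp add: Jn_iff_jordan jordan_lmeasurable)
  have incl: "B \<subseteq> S t \<and> S t \<subseteq> A" if "t \<in> {0..1}" for t
  proof
    show "S t \<subseteq> A"
      using that RA by (auto simp: S_pos)
    obtain C where C: "C \<in> F"
      using F_ne by blast
    then have "B \<subseteq> R C t"
      using R(2)[OF C] R(4)[OF C, of 0 t] that by auto
    then show "B \<subseteq> S t"
      using C that by (auto simp: S_pos)
  qed
  \<comment> \<open>Passing from \<open>B \<union> C\<close> to
    \<open>R C 1 = ci (B \<union> C)\<close> can lose frontier points, so the union covers
    \<open>A\<close> only up to a null set; for sets in \<open>Jn\<close> that already forces
    equality.\<close>
  have S1: "S 1 = A"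
  proof (rule Jn_eq_of_measure_le)
    have "A \<subseteq> (\<Union>C\<in>F. B \<union> C)"
      using F(2) F_ne by blast
    also have "\<dots> \<subseteq> S 1 \<union> (\<Union>C\<in>F. (B \<union> C) - R C 1)"
      by (auto simp: S_pos)
    finally have "measure lebesgue A \<le> measure lebesgue (S 1 \<union> (\<Union>C\<in>F. (B \<union> C) - R C 1))"
      by (intro measure_mono_fmeasurable fmeasurableD[OF meas(1)] fmeasurable.Un Sm
          fmeasurable.finite_UN[OF F(1)] fmeasurable.Diff Rm jordan_lmeasurable[OF jBC] fmeasurableD)
    also have "\<dots> = measure lebesgue (S 1)"
    proof (rule measure_Un_null_set)
      have "negligible ((B \<union> C) - R C 1)" if "C \<in> F" for C
        using symdiff_ci_subset_frontier[of "B \<union> C"] jBC[OF that] R(3)[OF that]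
        unfolding jordan_def by (auto intro: negligible_subset)
      then show "(\<Union>C\<in>F. (B \<union> C) - R C 1) \<in> null_sets lebesgue"
        using F(1) by (intro null_sets.finite_UN) (auto simp: negligible_iff_null_sets)
    qed (use Sm in \<open>auto dest: fmeasurableD\<close>)
    finally show "measure lebesgue A \<le> measure lebesgue (S 1)" .
  qed (use incl[of 1] Jn A in auto)
  have le: "dmu (S s) (S t) \<le> \<bar>t - s\<bar> * L" if "s \<le> 0" "t \<le> 0" for s t
  proof -
    have m: "(\<Inter>C\<in>F. R C t) \<in> lmeasurable" for t
      using jINT jordan_lmeasurable by blast
    have "dmu (S s) (S t) = dmu (\<Inter>C\<in>F. R C s) (\<Inter>C\<in>F. R C t)"
      using dmu_ci_left[OF jINT m] dmu_ci_left[OF jINT Sm] that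
      by (metis S'_def S_nonpos dmu_commute)
    also have "\<dots> \<le> (\<Sum>C\<in>F. dmu (R C s) (R C t))"
      using F(1) F_ne Rm by (intro dmu_INT_le) auto
    finally show ?thesis
      using sum_le[of s t] by simp
  qed
  have ge: "dmu (S s) (S t) \<le> \<bar>t - s\<bar> * L" if "s \<ge> 0" "t \<ge> 0" for s t
  proof -
    have "dmu (S s) (S t) \<le> (\<Sum>C\<in>F. dmu (R C s) (R C t))"
      unfolding S_pos[OF that(1)] S_pos[OF that(2)] using F(1) Rm by (intro dmu_UN_le) auto
    then show ?thesis
      using sum_le[of s t] by simp
  qed
  have "dmu (S s) (S t) \<le> \<bar>t - s\<bar> * L" for s t
    by (rule submetric_glue[where a = 0, OF Sm le ge])
  moreover have "L = dmu A B"
    using dmu_mono_eq[of B A] sub meas by (simp add: L_def dmu_commute)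
  ultimately show "interpolation (\<lambda>t. step2 N \<epsilon> t A B) B A"
    using Jn S0 S1 by (simp add: interpolation_def flip: S_def)
  show "t \<in> {0..1} \<Longrightarrow> B \<subseteq> step2 N \<epsilon> t A B \<and> step2 N \<epsilon> t A B \<subseteq> A"
    using incl[of t] by (simp add: S_def)
qed

section \<open>Averages of arbitrary pairs\<close>

lemma interpolationD:
  assumes "interpolation S B A"
  shows "S t \<in> Jn" "S t \<in> lmeasurable" "S 0 = B" "S 1 = A" "dmu (S s) (S t) \<le> \<bar>t - s\<bar> * dmu A B"
  using assms jordan_lmeasurable unfolding interpolation_def Jn_iff_jordan by blast+

lemma interpolation_flip:
  assumes "interpolation S B A"
  shows "interpolation (\<lambda>t. S (1 - t)) A B"
proof -
  note D = interpolationD[OF assms]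
  have "dmu (S (1 - s)) (S (1 - t)) \<le> \<bar>t - s\<bar> * dmu B A" for s t
    using D(5)[of "1 - s" "1 - t"] by (simp add: dmu_commute[of B A] abs_minus_commute[of t s])
  then show ?thesis
    using D(1,3,4) by (simp add: interpolation_def)
qed

lemma interpolation_dmu_eq:
  assumes S: "interpolation S B A" and st: "s \<in> {0..1}" "t \<in> {0..1}"
  shows "dmu (S s) (S t) = \<bar>t - s\<bar> * dmu A B"
proof -
  have *: "dmu (S s) (S t) = (t - s) * dmu A B" if "0 \<le> s" "s \<le> t" "t \<le> 1" for s t
  proof -
    note D = interpolationD[OF S]
    have "dmu A B \<le> dmu (S 0) (S s) + dmu (S s) (S t) + dmu (S t) (S 1)"
      using dmu_triangle[OF D(2) D(2) D(2), of 0 1 s] dmu_triangle[OF D(2) D(2) D(2), of s 1 t]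
        dmu_commute[of A B]
      by (simp add: D(3,4))
    moreover have "dmu (S 0) (S s) \<le> s * dmu A B" "dmu (S t) (S 1) \<le> (1 - t) * dmu A B"
      "dmu (S s) (S t) \<le> (t - s) * dmu A B"
      using D(5)[of 0 s] D(5)[of t 1] D(5)[of s t] that by auto
    ultimately show ?thesis
      by (simp add: algebra_simps)
  qed
  show ?thesis
    using *[of s t] *[of t s] st by (cases "s \<le> t") (auto simp: dmu_commute)
qed

text \<open>For nested sets \<open>dmu\<close> is the increase of measure, so the metric equality
  between parameters 0 and \<open>t\<close> turns into the measure formula.\<close>

lemma interpolation_measure_eq:
  assumes S: "interpolation S B A" and t: "t \<in> {0..1}" and incl: "B \<subseteq> S t" "S t \<subseteq> A"
  shows "measure lebesgue (S t) = t * measure lebesgue A + (1 - t) * measure lebesgue B"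
proof -
  note D = interpolationD[OF S]
  have m: "A \<in> lmeasurable" "B \<in> lmeasurable"
    using D(2)[of 0] D(2)[of 1] D(3,4) by auto
  have "dmu B (S t) = t * dmu A B"
    using interpolation_dmu_eq[OF S, of 0 t] t D(3) by auto
  then have "measure lebesgue (S t) - measure lebesgue B = t * (measure lebesgue A - measure lebesgue B)"
    using dmu_mono_eq[OF incl(1) m(2) D(2)] dmu_mono_eq[OF order_trans[OF incl] m(2,1)]
    by (simp add: dmu_commute)
  then show ?thesis
    by (simp add: algebra_simps)
qed

text \<open>The rule for negative parameters is the rule beyond 1 with the sets exchanged, so the
  estimates are needed only for nonnegative parameters.\<close>

lemma step3_commute: "step3 N \<epsilon> t A B = step3 N \<epsilon> (1 - t) B A"
  by (auto simp: step3_def Let_def Int_commute Un_commute)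

lemma ci_Int_symdiff_negligible:
  assumes "A \<in> Jn" "B \<in> Jn"
  shows "ci (A \<inter> B) \<subseteq> A \<inter> B" "negligible (A \<inter> B - ci (A \<inter> B))"
proof -
  have j: "jordan (A \<inter> B)"
    using assms jordan_Int by (auto simp: Jn_iff_jordan)
  have "closed (A \<inter> B)"
    using assms Jn_closed by blast
  then show "ci (A \<inter> B) \<subseteq> A \<inter> B"
    using ci_subset_closure[of "A \<inter> B"] by (metis closure_closed)
  show "negligible (A \<inter> B - ci (A \<inter> B))"
    using symdiff_ci_subset_frontier[of "A \<inter> B"] j unfolding jordan_def
    by (auto intro: negligible_subset)
qed

text \<open>\<open>ci (A \<inter> B)\<close> and \<open>A \<inter> B\<close> differ by a null set.
  Hence the speeds of the two nested averages in Step 3 add up to \<open>dmu A B\<close> with no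
  loss.\<close>

lemma dmu_eq_add_ci_Int:
  assumes "A \<in> Jn" "B \<in> Jn"
  shows "dmu A B = dmu A (ci (A \<inter> B)) + dmu B (ci (A \<inter> B))"
proof -
  let ?I = "ci (A \<inter> B)"
  have j: "jordan A" "jordan B" "jordan (A \<inter> B)"
    using assms jordan_Int by (auto simp: Jn_iff_jordan)
  then have m: "A \<in> lmeasurable" "B \<in> lmeasurable" "A \<inter> B \<in> lmeasurable" "?I \<in> lmeasurable"
    using jordan_lmeasurable jordan_ci by auto
  have I: "measure lebesgue ?I = measure lebesgue (A \<inter> B)"
    using j measure_ci by auto
  have "dmu A B = measure lebesgue (A - B) + measure lebesgue (B - A)"
    unfolding dmu_def using m by (subst measure_Un3) (auto intro: fmeasurable.Diff simp: Diff_Int_distrib2)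
  also have "\<dots> = (measure lebesgue A - measure lebesgue (A \<inter> B)) + (measure lebesgue B - measure lebesgue (A \<inter> B))"
    using measurable_measure_Diff[of A lebesgue "A \<inter> B"] measurable_measure_Diff[of B lebesgue "A \<inter> B"] m
    by (simp add: fmeasurableD Diff_Int)
  also have "\<dots> = dmu A ?I + dmu B ?I"
    using dmu_mono_eq[of ?I A] dmu_mono_eq[of ?I B] ci_Int_symdiff_negligible(1)[OF assms] m I
    by (simp add: dmu_commute)
  finally show ?thesis .
qed

lemma step3_aux:
  fixes A B :: "'a::euclidean_space set"
  assumes N: "1 \<le> N" and \<epsilon>: "\<epsilon> > 0" and A: "A \<in> Jn" and B: "B \<in> Jn"
    and nested: "\<not> A \<subseteq> B" "\<not> B \<subseteq> A"
  defines "S \<equiv> \<lambda>t. step3 N \<epsilon> t A B"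
  shows "t \<ge> 0 \<Longrightarrow> S t \<in> Jn" "S 0 = B" "S 1 = A"
    "0 \<le> s \<Longrightarrow> s \<le> 1 \<Longrightarrow> 0 \<le> t \<Longrightarrow> t \<le> 1 \<Longrightarrow> dmu (S s) (S t) \<le> \<bar>t - s\<bar> * dmu A B"
    "1 \<le> s \<Longrightarrow> 1 \<le> t \<Longrightarrow> dmu (S s) (S t) \<le> \<bar>t - s\<bar> * dmu A B"
    "t \<in> {0..1} \<Longrightarrow> ci (A \<inter> B) \<subseteq> S t \<and> S t \<subseteq> A \<union> B \<and>
      measure lebesgue (S t) = t * measure lebesgue A + (1 - t) * measure lebesgue B"
proof -
  define I where "I = ci (A \<inter> B)"
  define R1 where "R1 t = step2 N \<epsilon> t A I" for t
  define R2 where "R2 t = step2 N \<epsilon> (1 - t) B I" for t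
  have j: "jordan A" "jordan B" "jordan (A \<inter> B)"
    using A B jordan_Int by (auto simp: Jn_iff_jordan)
  have I: "I \<in> Jn"
    unfolding I_def using j(3) by (rule ci_in_Jn)
  have IAB: "I \<subseteq> A \<inter> B" "negligible (A \<inter> B - I)"
    using ci_Int_symdiff_negligible[OF A B] by (auto simp: I_def)
  have sub: "I \<subset> A" "I \<subset> B"
    using IAB(1) nested by auto
  have m: "A \<in> lmeasurable" "B \<in> lmeasurable" "A \<inter> B \<in> lmeasurable" "I \<in> lmeasurable"
    using j I jordan_lmeasurable by (auto simp: Jn_iff_jordan)
  have ip1: "interpolation R1 I A"
    unfolding R1_def by (rule interpolation_step2[OF N \<epsilon> A I sub(1)])
  have ip2': "interpolation (\<lambda>t. step2 N \<epsilon> t B I) I B"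
    by (rule interpolation_step2[OF N \<epsilon> B I sub(2)])
  have ip2: "interpolation R2 B I"
    unfolding R2_def using interpolation_flip[OF ip2'] by simp
  note D1 = interpolationD[OF ip1] and D2 = interpolationD[OF ip2]
  have incl: "I \<subseteq> R1 t" "R1 t \<subseteq> A" "I \<subseteq> R2 t" "R2 t \<subseteq> B" if "t \<in> {0..1}" for t
    using interpolation_step2(2)[OF N \<epsilon> A I sub(1), of t]
      interpolation_step2(2)[OF N \<epsilon> B I sub(2), of "1 - t"] that
    by (auto simp: R1_def R2_def)
  have S01: "S t = R1 t \<union> R2 t" if "t \<in> {0..1}" for t
    using that by (simp add: S_def step3_def Let_def R1_def R2_def I_def)
  define X where "X t = R1 t - A \<inter> B" for t
  have jX: "jordan (X t)" for t
    unfolding X_def using D1(1)[of t] j(3) jordan_Diff by (auto simp: Jn_iff_jordan)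
  have Xm: "X t \<in> lmeasurable" for t
    using jX jordan_lmeasurable by blast
  have S1': "S t = ci (X t) \<union> R2 t" if "t > 1" for t
    using that by (simp add: S_def step3_def Let_def R1_def R2_def I_def X_def)
  have d: "\<bar>t - s\<bar> * dmu A I + \<bar>t - s\<bar> * dmu I B = \<bar>t - s\<bar> * dmu A B" for s t :: real
    using dmu_eq_add_ci_Int[OF A B] by (simp add: I_def distrib_left dmu_commute)
  show Jn: "S t \<in> Jn" if "t \<ge> 0" for t
    using that S01[of t] S1'[of t] Un_in_Jn[OF D1(1) D2(1), of t t]
      Un_in_Jn[OF ci_in_Jn[OF jX] D2(1), of t t]
    by (cases "t \<le> 1") auto
  show "S 0 = B" "S 1 = A"
    using S01[of 0] S01[of 1] sub by (auto simp: D1 D2)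
  show "dmu (S s) (S t) \<le> \<bar>t - s\<bar> * dmu A B" if "0 \<le> s" "s \<le> 1" "0 \<le> t" "t \<le> 1" for s t
  proof -
    have "dmu (S s) (S t) \<le> dmu (R1 s) (R1 t) + dmu (R2 s) (R2 t)"
      using that by (simp add: S01 dmu_Un_le D1 D2)
    also have "\<dots> \<le> \<bar>t - s\<bar> * dmu A I + \<bar>t - s\<bar> * dmu I B"
      using D1(5) D2(5) by (rule add_mono)
    finally show ?thesis
      by (simp add: d)
  qed
  \<comment> \<open>Up to null sets one formula is valid for all \<open>t \<ge> 1\<close>, including
    \<open>t = 1\<close>, where the union rule gives \<open>A\<close> while
    \<open>X 1 \<union> R2 1\<close> lacks only part of \<open>A \<inter> B - I\<close>. Removing
    the fixed set \<open>A \<inter> B\<close> then does not increase \<open>dmu\<close>.\<close>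
  have SX: "dmu (S t) (X t \<union> R2 t) = 0" if "t \<ge> 1" for t
  proof (cases "t = 1")
    case True
    have "A - (X 1 \<union> R2 1) \<union> (X 1 \<union> R2 1 - A) \<subseteq> A \<inter> B - I"
      using sub by (auto simp: X_def D1 D2)
    then have "dmu A (X 1 \<union> R2 1) = 0"
      using IAB(2) by (intro dmu_eq_0) (auto intro: negligible_subset)
    then show ?thesis
      using True \<open>S 1 = A\<close> by simp
  next
    case False
    then have "dmu (S t) (X t \<union> R2 t) \<le> dmu (ci (X t)) (X t) + dmu (R2 t) (R2 t)"
      unfolding S1'[OF le_neq_trans[OF that False[symmetric]]]
      by (intro dmu_Un_le Xm D2(2) jordan_lmeasurable jordan_ci jX)
    then show ?thesis
      using dmu_ci[OF jX, of t] dmu_nonneg[of "S t" "X t \<union> R2 t"] by simp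
  qed
  show "dmu (S s) (S t) \<le> \<bar>t - s\<bar> * dmu A B" if "1 \<le> s" "1 \<le> t" for s t
  proof -
    have Sm: "S t \<in> lmeasurable" if "t \<ge> 1" for t
      using Jn[of t] that jordan_lmeasurable by (auto simp: Jn_iff_jordan)
    have Ym: "X t \<union> R2 t \<in> lmeasurable" for t
      using Xm D2(2) by blast
    have "dmu (S s) (S t) \<le> dmu (S s) (X s \<union> R2 s) + dmu (X s \<union> R2 s) (S t)"
      using that Sm Ym by (intro dmu_triangle) auto
    also have "\<dots> \<le> dmu (X s \<union> R2 s) (X t \<union> R2 t) + dmu (X t \<union> R2 t) (S t)"
      using that Sm Ym SX[of s] by (simp add: dmu_triangle)
    also have "\<dots> = dmu (X s \<union> R2 s) (X t \<union> R2 t)"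
      using SX[of t] that by (simp add: dmu_commute)
    also have "\<dots> \<le> dmu (X s) (X t) + dmu (R2 s) (R2 t)"
      using Xm D2(2) by (intro dmu_Un_le) auto
    also have "\<dots> \<le> dmu (R1 s) (R1 t) + dmu (R2 s) (R2 t)"
      unfolding X_def using D1(2) m(3) by (intro add_right_mono dmu_Diff_le) auto
    also have "\<dots> \<le> \<bar>t - s\<bar> * dmu A I + \<bar>t - s\<bar> * dmu I B"
      using D1(5) D2(5) by (rule add_mono)
    finally show ?thesis
      by (simp add: d)
  qed
  show "ci (A \<inter> B) \<subseteq> S t \<and> S t \<subseteq> A \<union> B \<and>
      measure lebesgue (S t) = t * measure lebesgue A + (1 - t) * measure lebesgue B"
    if t: "t \<in> {0..1}" for t
  proof (intro conjI)
    show "ci (A \<inter> B) \<subseteq> S t" "S t \<subseteq> A \<union> B"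
      using incl[OF t] S01[OF t] by (auto simp: I_def)
    have m1: "measure lebesgue (R1 t) = t * measure lebesgue A + (1 - t) * measure lebesgue I"
      using incl[OF t] by (intro interpolation_measure_eq[OF ip1 t])
    have "measure lebesgue (step2 N \<epsilon> (1 - t) B I)
        = (1 - t) * measure lebesgue B + (1 - (1 - t)) * measure lebesgue I"
      using incl(3,4)[OF t] t by (intro interpolation_measure_eq[OF ip2']) (auto simp: R2_def)
    then have m2: "measure lebesgue (R2 t) = (1 - t) * measure lebesgue B + t * measure lebesgue I"
      by (simp add: R2_def)
    \<comment> \<open>The intersection lies between \<open>I\<close> and
      \<open>A \<inter> B\<close>. In the inclusion-exclusion formula the terms with
      \<open>I\<close> cancel, because \<open>(1 - t) + t - 1 = 0\<close>.\<close>
    have "measure lebesgue (R1 t \<inter> R2 t) = measure lebesgue I"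
    proof (rule measure_negligible_symdiff[OF m(4)])
      have "(I - R1 t \<inter> R2 t) \<union> (R1 t \<inter> R2 t - I) \<subseteq> A \<inter> B - I"
        using incl[OF t] by blast
      then show "negligible ((I - R1 t \<inter> R2 t) \<union> (R1 t \<inter> R2 t - I))"
        using IAB(2) negligible_subset by blast
    qed
    then show "measure lebesgue (S t) = t * measure lebesgue A + (1 - t) * measure lebesgue B"
      using measure_Un3[OF D1(2) D2(2), of t t] S01[OF t] m1 m2 by (simp add: algebra_simps)
  qed
qed

theorem interpolation_step3:
  fixes A B :: "'a::euclidean_space set"
  assumes N: "1 \<le> N" and \<epsilon>: "\<epsilon> > 0" and A: "A \<in> Jn" and B: "B \<in> Jn"
    and nested: "\<not> A \<subseteq> B" "\<not> B \<subseteq> A"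
  shows "interpolation (\<lambda>t. step3 N \<epsilon> t A B) B A"
proof -
  define S where "S t = step3 N \<epsilon> t A B" for t
  note aux = step3_aux[OF N \<epsilon> A B nested, folded S_def]
  have S': "S t = step3 N \<epsilon> (1 - t) B A" for t
    unfolding S_def by (rule step3_commute)
  note aux' = step3_aux[OF N \<epsilon> B A nested(2,1)]
  have Jn: "S t \<in> Jn" for t
    using aux(1)[of t] aux'(1)[of "1 - t"] S'[of t] by (cases "t \<ge> 0") auto
  then have Sm: "S t \<in> lmeasurable" for t
    using jordan_lmeasurable by (auto simp: Jn_iff_jordan)
  have neg: "dmu (S s) (S t) \<le> \<bar>t - s\<bar> * dmu A B" if "s \<le> 0" "t \<le> 0" for s t
    using aux'(5)[of "1 - s" "1 - t"] that
    by (simp add: S' dmu_commute[of B A] abs_minus_commute)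
  \<comment> \<open>The gluing at 0 is done by hand, because to the right of 0 the estimate is so
    far available only up to 1.\<close>
  have le1: "dmu (S s) (S t) \<le> \<bar>t - s\<bar> * dmu A B" if "s \<le> 1" "t \<le> 1" for s t
  proof -
    have across: "dmu (S s) (S t) \<le> (t - s) * dmu A B" if "s \<le> 0" "0 \<le> t" "t \<le> 1" for s t
    proof -
      have "dmu (S s) (S t) \<le> dmu (S s) (S 0) + dmu (S 0) (S t)"
        by (intro dmu_triangle Sm)
      also have "\<dots> \<le> (0 - s) * dmu A B + (t - 0) * dmu A B"
        using neg[of s 0] aux(4)[of 0 t] that by (intro add_mono) auto
      finally show ?thesis
        by (simp add: algebra_simps)
    qed
    show ?thesis
      using neg[of s t] aux(4)[of s t] across[of s t] across[of t s] that
      by (cases "s \<le> 0"; cases "t \<le> 0") (auto simp: dmu_commute)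
  qed
  have "dmu (S s) (S t) \<le> \<bar>t - s\<bar> * dmu A B" for s t
    by (rule submetric_glue[where a = 1, OF Sm le1 aux(5)])
  then show ?thesis
    using Jn aux(2,3) by (simp add: interpolation_def flip: S_def)
qed

section \<open>The measure average of two arbitrary sets in \<open>Jn\<close>\<close>

theorem interpolation_mavg:
  fixes A B :: "'a::euclidean_space set"
  assumes N: "1 \<le> N" and \<epsilon>: "\<epsilon> > 0" and A: "A \<in> Jn" and B: "B \<in> Jn"
  shows "interpolation (\<lambda>t. mavg N \<epsilon> t A B) B A"
    and "t \<in> {0..1} \<Longrightarrow> ci (A \<inter> B) \<subseteq> mavg N \<epsilon> t A B \<and> mavg N \<epsilon> t A B \<subseteq> A \<union> B \<and>
      measure lebesgue (mavg N \<epsilon> t A B) = t * measure lebesgue A + (1 - t) * measure lebesgue B"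
proof -
  have ci: "ci A = A" "ci B = B"
    using A B by (auto simp: Jn_iff_jordan)
  consider "A = B" | "B \<subset> A" | "A \<subset> B" | "\<not> A \<subseteq> B" "\<not> B \<subseteq> A"
    by blast
  then have "interpolation (\<lambda>t. mavg N \<epsilon> t A B) B A \<and>
    (t \<in> {0..1} \<longrightarrow> ci (A \<inter> B) \<subseteq> mavg N \<epsilon> t A B \<and> mavg N \<epsilon> t A B \<subseteq> A \<union> B \<and>
      measure lebesgue (mavg N \<epsilon> t A B) = t * measure lebesgue A + (1 - t) * measure lebesgue B)"
  proof cases
    case 1
    then show ?thesis
      using A ci by (auto simp: mavg_def interpolation_def algebra_simps)
  next
    case 2
    then have eq: "mavg N \<epsilon> t A B = step2 N \<epsilon> t A B" for t
      by (auto simp: mavg_def)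
    have "A \<inter> B = B" "A \<union> B = A"
      using 2 by auto
    then show ?thesis
      using interpolation_step2[OF N \<epsilon> A B 2] interpolation_measure_eq[of "\<lambda>t. step2 N \<epsilon> t A B" B A t]
      by (simp add: eq ci)
  next
    case 3
    then have eq: "mavg N \<epsilon> t A B = step2 N \<epsilon> (1 - t) B A" for t
      by (auto simp: mavg_def)
    have AB: "A \<inter> B = A" "A \<union> B = B"
      using 3 by auto
    note ip = interpolation_step2(1)[OF N \<epsilon> B A 3]
    have incl: "A \<subseteq> step2 N \<epsilon> (1 - t) B A \<and> step2 N \<epsilon> (1 - t) B A \<subseteq> B" if "t \<in> {0..1}"
      using interpolation_step2(2)[OF N \<epsilon> B A 3, of "1 - t"] that by simp
    have "measure lebesgue (step2 N \<epsilon> (1 - t) B A) = t * measure lebesgue A + (1 - t) * measure lebesgue B"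
      if "t \<in> {0..1}"
      using interpolation_measure_eq[OF ip, of "1 - t"] incl that by simp
    then show ?thesis
      using interpolation_flip[OF ip] incl by (simp add: eq AB ci)
  next
    case 4
    then have eq: "mavg N \<epsilon> t A B = step3 N \<epsilon> t A B" for t
      by (auto simp: mavg_def)
    show ?thesis
      using interpolation_step3[OF N \<epsilon> A B 4] step3_aux(6)[OF N \<epsilon> A B 4, of t]
      by (simp add: eq)
  qed
  then show "interpolation (\<lambda>t. mavg N \<epsilon> t A B) B A"
    "t \<in> {0..1} \<Longrightarrow> ci (A \<inter> B) \<subseteq> mavg N \<epsilon> t A B \<and> mavg N \<epsilon> t A B \<subseteq> A \<union> B \<and>
      measure lebesgue (mavg N \<epsilon> t A B) = t * measure lebesgue A + (1 - t) * measure lebesgue B"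
    by blast+
qed

theorem mainTheorem8:
  shows "\<exists>N0::real. \<forall>N\<ge>N0. \<forall>\<epsilon>>0. \<forall>A\<in>(Jn :: 'a::euclidean_space set set). \<forall>B\<in>Jn. \<forall>s t::real.
     mavg N \<epsilon> t A B \<in> Jn \<and>
     mavg N \<epsilon> 0 A B = B \<and> mavg N \<epsilon> 1 A B = A \<and>
     dmu (mavg N \<epsilon> s A B) (mavg N \<epsilon> t A B) \<le> \<bar>t - s\<bar> * dmu A B \<and>
     (s \<in> {0..1} \<and> t \<in> {0..1} \<longrightarrow>
        measure lebesgue (mavg N \<epsilon> t A B) = t * measure lebesgue A + (1 - t) * measure lebesgue B \<and>
        dmu (mavg N \<epsilon> s A B) (mavg N \<epsilon> t A B) = \<bar>t - s\<bar> * dmu A B \<and>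
        ci (A \<inter> B) \<subseteq> mavg N \<epsilon> t A B \<and> mavg N \<epsilon> t A B \<subseteq> A \<union> B)"
proof (rule exI[of _ 1], intro allI impI ballI)
  fix N \<epsilon> s t :: real and A B :: "'a set"
  assume "1 \<le> N" "0 < \<epsilon>" "A \<in> Jn" "B \<in> Jn"
  note ip = interpolation_mavg[OF this]
  show "mavg N \<epsilon> t A B \<in> Jn \<and>
     mavg N \<epsilon> 0 A B = B \<and> mavg N \<epsilon> 1 A B = A \<and>
     dmu (mavg N \<epsilon> s A B) (mavg N \<epsilon> t A B) \<le> \<bar>t - s\<bar> * dmu A B \<and>
     (s \<in> {0..1} \<and> t \<in> {0..1} \<longrightarrow>
        measure lebesgue (mavg N \<epsilon> t A B) = t * measure lebesgue A + (1 - t) * measure lebesgue B \<and>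
        dmu (mavg N \<epsilon> s A B) (mavg N \<epsilon> t A B) = \<bar>t - s\<bar> * dmu A B \<and>
        ci (A \<inter> B) \<subseteq> mavg N \<epsilon> t A B \<and> mavg N \<epsilon> t A B \<subseteq> A \<union> B)"
    using interpolationD[OF ip(1)] interpolation_dmu_eq[OF ip(1)] ip(2)[of t] by blast
qed

end
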